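(* Let $L(n)$ be either $\mathrm{NC}(n)$ for all $n$, or $\mathrm{Int}(n)$ for all $n$, and let $\mathrm{Kr}L(n)=\{\beta^{\mathrm{Kr}}:\beta\in L(n)\}$. Define, as polynomials in $Y,A,B$, $$m_n=\sum_{\alpha\in\mathrm{Int}(n),\ \beta\in L(n)}Y^{\|\alpha^{-1}\beta\|}A^{\|\alpha\|}B^{\|\beta\|},\qquad \kappa_n=\sum_{\substack{\alpha\in\mathrm{KrInt}(n),\ \beta\in\mathrm{Kr}L(n)\\ \alpha\wedge_{\mathrm{KrInt}}\beta=0_n}}Y^{\|\alpha^{-1}\beta\|}A^{\|\alpha^{-1}\gamma_n\|}B^{\|\beta^{-1}\gamma_n\|}.$$ Then for every $n\ge1$, $$m_n=\sum_{\sigma\in\mathrm{Int}(n)}\prod_{c\in\sigma}\kappa_{|c|},$$ i.e. $M(X)=\sum_n m_nX^n$ is the boolean transform of $K(X)=\sum_n\kappa_nX^n$ (equivalently $M=K/(1-K)$).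
   Context: $\mathcal S_n$ is the symmetric group on $[n]$; $\#\alpha$ is the number of cycles of $\alpha$ and $\|\alpha\|=n-\#\alpha$. $\gamma_n=(1\,2\,\cdots\,n)$ is the full cycle and $0_n$ the identity permutation. $\mathrm{NC}(n)$ is the set of non-crossing partitions of $[n]$, each identified with the permutation whose cycles are its blocks with elements in increasing order; $\mathrm{Int}(n)\subseteq\mathrm{NC}(n)$ is the set of interval partitions. $\mathrm{NC}(n)$ is ordered by $\rho\le\tau$ iff each block of $\rho$ lies in a block of $\tau$. The Kreweras complement of $\alpha\in\mathrm{NC}(n)$ is $\alpha^{\mathrm{Kr}}=\alpha^{-1}\gamma_n\in\mathrm{NC}(n)$; $\mathrm{KrInt}(n)=\{\alpha^{\mathrm{Kr}}:\alpha\in\mathrm{Int}(n)\}$. For $\alpha,\beta\in\mathrm{NC}(n)$, $\alpha\wedge_{\mathrm{KrInt}}\beta=\max\{\rho\in\mathrm{KrInt}(n):\rho\le\alpha,\rho\le\beta\}$. The product $\prod_{c\in\sigma}$ runs over blocks of $\sigma$. *)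

theory Defs
  imports
    "HOL-Library.Disjoint_Sets"
    "HOL-Combinatorics.Cycles"
    "HOL-Combinatorics.Orbits"
    "HOL-Computational_Algebra.Polynomial"
    "HOL-Computational_Algebra.Formal_Power_Series"
begin

text \<open>
  A permutation of \<open>{1..n}\<close> is a function on \<open>nat\<close> that is the identity outside \<open>{1..n}\<close>,
  in accordance with the library predicate \<open>permutes\<close>. Products of permutations are compositions
  of functions, the right factor being applied first.
\<close>

definition full_cycle :: "nat \<Rightarrow> nat \<Rightarrow> nat" where
  "full_cycle n = cycle_of_list [1..<Suc n]"

text \<open>Fixed points count as cycles of length one: \<open>orbit \<alpha> x\<close> is \<open>{x}\<close> for them.\<close>

definition cycles_of :: "nat \<Rightarrow> (nat \<Rightarrow> nat) \<Rightarrow> nat set set" where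
  "cycles_of n \<alpha> = orbit \<alpha> ` {1..n}"

definition perm_norm :: "nat \<Rightarrow> (nat \<Rightarrow> nat) \<Rightarrow> nat" where
  "perm_norm n \<alpha> = n - card (cycles_of n \<alpha>)"

definition noncrossing :: "nat set set \<Rightarrow> bool" where
  "noncrossing P \<longleftrightarrow>
     (\<forall>V\<in>P. \<forall>W\<in>P. \<forall>a\<in>V. \<forall>b\<in>W. \<forall>c\<in>V. \<forall>d\<in>W. a < b \<and> b < c \<and> c < d \<longrightarrow> V = W)"

text \<open>The permutation whose cycles are the blocks of \<open>P\<close> with their elements in increasing order.\<close>

definition perm_of_partition :: "nat set set \<Rightarrow> nat \<Rightarrow> nat" where
  "perm_of_partition P x =
     (if x \<in> \<Union>P then cycle_of_list (sorted_list_of_set (THE V. V \<in> P \<and> x \<in> V)) x else x)"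

definition NC :: "nat \<Rightarrow> (nat \<Rightarrow> nat) set" where
  "NC n = perm_of_partition ` {P. partition_on {1..n} P \<and> noncrossing P}"

definition IntP :: "nat \<Rightarrow> (nat \<Rightarrow> nat) set" where
  "IntP n = perm_of_partition ` {P. partition_on {1..n} P \<and> (\<forall>V\<in>P. \<exists>i j. V = {i..j})}"

lemma IntP_subset_NC: "IntP n \<subseteq> NC n"
proof -
  have "noncrossing P" if "partition_on {1..n} P" "\<forall>V\<in>P. \<exists>i j. V = {i..j}" for P
    unfolding noncrossing_def
  proof (intro ballI impI)
    fix V W a b c d
    assume *: "V \<in> P" "W \<in> P" "a \<in> V" "b \<in> W" "c \<in> V" "d \<in> W" "a < b \<and> b < c \<and> c < d"
    then have "b \<in> V" using that(2) by fastforce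
    with * that(1) show "V = W" by (auto simp: partition_on_def disjoint_def)
  qed
  then show ?thesis unfolding IntP_def NC_def by blast
qed

definition perm_le :: "nat \<Rightarrow> (nat \<Rightarrow> nat) \<Rightarrow> (nat \<Rightarrow> nat) \<Rightarrow> bool" where
  "perm_le n \<rho> \<tau> \<longleftrightarrow> refines {1..n} (cycles_of n \<rho>) (cycles_of n \<tau>)"

definition kreweras :: "nat \<Rightarrow> (nat \<Rightarrow> nat) \<Rightarrow> nat \<Rightarrow> nat" where
  "kreweras n \<alpha> = inv \<alpha> \<circ> full_cycle n"

definition KrInt :: "nat \<Rightarrow> (nat \<Rightarrow> nat) set" where
  "KrInt n = kreweras n ` IntP n"

definition meet_KrInt :: "nat \<Rightarrow> (nat \<Rightarrow> nat) \<Rightarrow> (nat \<Rightarrow> nat) \<Rightarrow> nat \<Rightarrow> nat" where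
  "meet_KrInt n \<alpha> \<beta> =
     (THE \<rho>. \<rho> \<in> KrInt n \<and> perm_le n \<rho> \<alpha> \<and> perm_le n \<rho> \<beta> \<and>
        (\<forall>\<rho>'\<in>KrInt n. perm_le n \<rho>' \<alpha> \<and> perm_le n \<rho>' \<beta> \<longrightarrow> perm_le n \<rho>' \<rho>))"

text \<open>The polynomial ring in three variables over the integers, built as \<open>\<int>[Y][A][B]\<close>.\<close>

type_synonym poly3 = "int poly poly poly"

definition var_Y :: poly3 where "var_Y = [:[:[:0, 1:]:]:]"
definition var_A :: poly3 where "var_A = [:[:0, 1:]:]"
definition var_B :: poly3 where "var_B = [:0, 1:]"

definition m_poly :: "(nat \<Rightarrow> (nat \<Rightarrow> nat) set) \<Rightarrow> nat \<Rightarrow> poly3" where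
  "m_poly L n = (\<Sum>(\<alpha>, \<beta>) \<in> IntP n \<times> L n.
     var_Y ^ perm_norm n (inv \<alpha> \<circ> \<beta>) * var_A ^ perm_norm n \<alpha> * var_B ^ perm_norm n \<beta>)"

definition kappa_poly :: "(nat \<Rightarrow> (nat \<Rightarrow> nat) set) \<Rightarrow> nat \<Rightarrow> poly3" where
  "kappa_poly L n =
     (\<Sum>(\<alpha>, \<beta>) \<in> {(\<alpha>, \<beta>). \<alpha> \<in> KrInt n \<and> \<beta> \<in> kreweras n ` L n \<and> meet_KrInt n \<alpha> \<beta> = id}.
       var_Y ^ perm_norm n (inv \<alpha> \<circ> \<beta>) *
       var_A ^ perm_norm n (inv \<alpha> \<circ> full_cycle n) *
       var_B ^ perm_norm n (inv \<beta> \<circ> full_cycle n))"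

text \<open>The generating series have no constant term: the sums run over \<open>n \<ge> 1\<close>.\<close>

definition gen_series :: "(nat \<Rightarrow> poly3) \<Rightarrow> poly3 fps" where
  "gen_series f = Abs_fps (\<lambda>n. if n = 0 then 0 else f n)"

end

theory Submission
  imports Defs
begin

text \<open>
  Say that a permutation \<open>\<alpha>\<close> of \<open>{1..n}\<close> splits at \<open>d\<close> if it preserves \<open>{1..d}\<close>. For non-crossing \<open>\<beta>\<close>
  the block of the Kreweras complement of \<open>\<beta>\<close> containing \<open>n\<close> consists of the splitting points of
  \<open>\<beta>\<close>, and for an interval partition all other blocks of the complement are singletons. Hence the
  meet of the complements of \<open>\<alpha>\<close> and \<open>\<beta>\<close> is trivial iff \<open>n\<close> is the only common splitting point.
  As the exponents in \<open>\<kappa>\<^sub>n\<close> are invariant under conjugation and inversion, \<open>\<kappa>\<^sub>n\<close> is the part of the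
  sum \<open>m\<^sub>n\<close> over pairs without a common splitting point below \<open>n\<close>. Cutting a pair at its first
  common splitting point gives \<open>m\<^sub>n = \<kappa>\<^sub>1 m\<^bsub>n-1\<^esub> + \<dots> + \<kappa>\<^sub>n m\<^sub>0\<close> with \<open>m\<^sub>0 = 1\<close>, and cutting off the first
  block shows that the sum over interval partitions satisfies the same recursion.
\<close>

subsection \<open>Permutations with increasing cycles\<close>

text \<open>The cyclic successor of \<open>x\<close> in \<open>V\<close>: the maximum wraps round to
  the minimum. It describes an increasing cycle pointwise, without list indices.\<close>

definition succ_in :: "nat set \<Rightarrow> nat \<Rightarrow> nat" where
  "succ_in V x = (if \<exists>y\<in>V. x < y then LEAST y. y \<in> V \<and> x < y else LEAST y. y \<in> V)"

lemma succ_in_mem: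
  assumes "x \<in> V"
  shows "succ_in V x \<in> V"
proof (cases "\<exists>y\<in>V. x < y")
  case True
  then have "\<exists>y. y \<in> V \<and> x < y" by blast
  from LeastI_ex[OF this] True show ?thesis by (simp add: succ_in_def)
next
  case False
  have "(LEAST y. y \<in> V) \<in> V" using assms by (rule LeastI)
  then show ?thesis using False by (simp add: succ_in_def)
qed

lemma Least_add_nat:
  fixes k :: nat
  assumes "\<exists>y. P y"
  shows "(LEAST z. \<exists>y. P y \<and> z = y + k) = (LEAST y. P y) + k"
proof (rule Least_equality)
  show "\<exists>y. P y \<and> (LEAST y. P y) + k = y + k"
    using LeastI_ex[OF assms] by blast
qed (auto intro: Least_le)

text \<open>Prepares for the shifted half of a concatenation. Membership of \<open>x\<close> makes
  \<open>V\<close> nonempty, so the wrap-around minimum is shifted as well.\<close>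

lemma succ_in_image_add:
  assumes "x \<in> V"
  shows "succ_in ((\<lambda>x. x + k) ` V) (x + k) = succ_in V x + k"
proof (cases "\<exists>y\<in>V. x < y")
  case True
  have "z \<in> (\<lambda>x. x + k) ` V \<and> x + k < z \<longleftrightarrow> (\<exists>y. (y \<in> V \<and> x < y) \<and> z = y + k)" for z
    by auto
  then have "(LEAST z. z \<in> (\<lambda>x. x + k) ` V \<and> x + k < z) = (LEAST y. y \<in> V \<and> x < y) + k"
    using Least_add_nat[of "\<lambda>y. y \<in> V \<and> x < y" k] True by (simp add: Bex_def)
  then show ?thesis using True by (auto simp: succ_in_def)
next
  case False
  have "(LEAST z. z \<in> (\<lambda>x. x + k) ` V) = (LEAST y. y \<in> V) + k"
    using Least_add_nat[of "\<lambda>y. y \<in> V" k] assms by (auto simp: image_iff Bex_def)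
  then show ?thesis using False by (auto simp: succ_in_def)
qed

text \<open>Powers of the cycle rotate the list, so index \<open>j\<close> moves to
  \<open>(j + k) mod length xs\<close>. The case \<open>k = 1\<close> gives the successor, and all
  positive \<open>k\<close> together give the orbit.\<close>

lemma cycle_of_sorted_list:
  assumes "finite V" "x \<in> V"
  shows "cycle_of_list (sorted_list_of_set V) x = succ_in V x"
    and "orbit (cycle_of_list (sorted_list_of_set V)) x = V"
proof -
  define xs where "xs = sorted_list_of_set V"
  define c where "c = cycle_of_list xs"
  have xs: "sorted_wrt (<) xs" "distinct xs" "set xs = V"
    using assms(1) by (auto simp: xs_def)
  have less_iff: "xs ! i < xs ! j \<longleftrightarrow> i < j" if "i < length xs" "j < length xs" for i j
    by (metis xs(1) that sorted_wrt_nth_less linorder_neqE_nat order_less_asym order_less_irrefl)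
  obtain i where i: "i < length xs" "x = xs ! i"
    using assms(2) xs(3) by (metis in_set_conv_nth)
  have pow: "(c ^^ k) (xs ! j) = xs ! ((j + k) mod length xs)" if "j < length xs" for j k
  proof -
    have "map (c ^^ k) xs = rotate k xs"
      unfolding c_def using xs(2) by (rule cyclic_rotation)
    then have "map (c ^^ k) xs ! j = rotate k xs ! j" by simp
    then show ?thesis using that by (simp add: nth_rotate add.commute)
  qed
  show "cycle_of_list (sorted_list_of_set V) x = succ_in V x"
  proof (cases "Suc i < length xs")
    case True
    have "succ_in V x = xs ! Suc i"
    proof -
      have "(LEAST y. y \<in> V \<and> x < y) = xs ! Suc i"
      proof (rule Least_equality)
        show "xs ! Suc i \<in> V \<and> x < xs ! Suc i"
          using True xs(3) i by (auto simp: less_iff)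
        fix y assume y: "y \<in> V \<and> x < y"
        then obtain j where j: "j < length xs" "y = xs ! j"
          using xs(3) by (metis in_set_conv_nth)
        then have "i < j" using y i less_iff by simp
        then show "xs ! Suc i \<le> y"
          using less_iff[OF j(1) True] j by (simp add: linorder_not_less[symmetric])
      qed
      moreover have "\<exists>y\<in>V. x < y"
        using True xs(3) i less_iff[of i "Suc i"] nth_mem by blast
      ultimately show ?thesis by (simp add: succ_in_def)
    qed
    then show ?thesis using pow[of i 1] i True by (simp add: c_def xs_def)
  next
    case False
    then have i': "Suc i = length xs" using i by simp
    have "succ_in V x = xs ! 0"
    proof -
      have "\<not> (\<exists>y\<in>V. x < y)"
      proof
        assume "\<exists>y\<in>V. x < y"
        then obtain j where j: "j < length xs" "x < xs ! j"
          using xs(3) by (metis in_set_conv_nth)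
        then show False using i less_iff[of i j] i' by simp
      qed
      moreover have "(LEAST y. y \<in> V) = xs ! 0"
      proof (rule Least_equality)
        show "xs ! 0 \<in> V" using i xs(3) by (metis nth_mem gr_zeroI less_nat_zero_code)
        fix y assume "y \<in> V"
        then obtain j where j: "j < length xs" "y = xs ! j"
          using xs(3) by (metis in_set_conv_nth)
        then show "xs ! 0 \<le> y"
          using less_iff[of j 0] i(1) by (metis less_nat_zero_code linorder_not_less gr_zeroI)
      qed
      ultimately show ?thesis by (simp add: succ_in_def)
    qed
    then show ?thesis using pow[of i 1] i i' by (simp add: c_def xs_def)
  qed
  have "orbit c x = V"
  proof
    have "(c ^^ k) x \<in> V" for k
      using pow[OF i(1), of k] i xs(3) by (metis nth_mem mod_less_divisor gr_zeroI less_nat_zero_code)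
    then show "orbit c x \<subseteq> V" by (auto simp: orbit_altdef)
    show "V \<subseteq> orbit c x"
    proof
      fix y assume "y \<in> V"
      then obtain j where j: "j < length xs" "y = xs ! j"
        using xs(3) by (metis in_set_conv_nth)
      \<comment> \<open>Orbits consist of positive powers; the extra turn by
        \<open>length xs\<close> keeps the exponent positive even if
        \<open>j \<le> i\<close>.\<close>
      have "(c ^^ (j + length xs - i)) x = y"
        using pow[OF i(1), of "j + length xs - i"] i j by simp
      moreover have "0 < j + length xs - i" using i by simp
      ultimately show "y \<in> orbit c x" by (auto simp: orbit_altdef)
    qed
  qed
  then show "orbit (cycle_of_list (sorted_list_of_set V)) x = V" by (simp add: c_def xs_def)
qed

lemma partition_on_block_unique:
  assumes "partition_on A P" "V \<in> P" "W \<in> P" "x \<in> V" "x \<in> W"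
  shows "V = W"
  using assms partition_onD2[OF assms(1)] unfolding disjoint_def by blast

lemma perm_of_partition_apply:
  assumes P: "partition_on A P" and V: "V \<in> P" "x \<in> V"
  shows "perm_of_partition P x = cycle_of_list (sorted_list_of_set V) x"
proof -
  have "(THE W. W \<in> P \<and> x \<in> W) = V"
    using V partition_on_block_unique[OF P] by (intro the_equality) auto
  moreover have "x \<in> \<Union>P" using V by blast
  ultimately show ?thesis by (simp add: perm_of_partition_def)
qed

lemma
  assumes P: "partition_on A P" and fin: "finite A" and V: "V \<in> P" "x \<in> V"
  shows perm_of_partition_succ_in: "perm_of_partition P x = succ_in V x"
    and orbit_perm_of_partition: "orbit (perm_of_partition P) x = V"
proof -
  let ?c = "cycle_of_list (sorted_list_of_set V)"
  have "V \<subseteq> A" using V(1) partition_onD1[OF P] by blast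
  then have V': "finite V" using fin finite_subset by blast
  show "perm_of_partition P x = succ_in V x"
    using perm_of_partition_apply[OF P V] cycle_of_sorted_list(1)[OF V' V(2)] by simp
  have "orbit ?c x = orbit (perm_of_partition P) x"
  proof (rule orbit_cong0[of _ V])
    show "?c \<in> V \<rightarrow> V"
      using cycle_of_sorted_list(1)[OF V'] succ_in_mem by auto
    show "?c y = perm_of_partition P y" if "y \<in> V" for y
      using perm_of_partition_apply[OF P V(1) that] by simp
  qed (use V in auto)
  then show "orbit (perm_of_partition P) x = V"
    using cycle_of_sorted_list(2)[OF V' V(2)] by simp
qed

text \<open>On the finite set \<open>A\<close> surjectivity is enough, and a preimage of
  \<open>y\<close> is found by inverting the cycle of its own block.\<close>

lemma perm_of_partition_permutes:
  assumes P: "partition_on A P" and fin: "finite A"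
  shows "perm_of_partition P permutes A"
proof (rule bij_imp_permutes)
  have A: "A = \<Union>P" using partition_onD1[OF P] .
  show "perm_of_partition P x = x" if "x \<notin> A" for x
    using that A by (auto simp: perm_of_partition_def)
  have "perm_of_partition P ` A = A"
  proof (intro equalityI subsetI)
    fix y assume "y \<in> perm_of_partition P ` A"
    then obtain x V where "V \<in> P" "x \<in> V" "y = perm_of_partition P x" using A by auto
    then show "y \<in> A"
      using perm_of_partition_succ_in[OF P fin] succ_in_mem A by (metis UnionI)
  next
    fix y assume "y \<in> A"
    then obtain V where V: "V \<in> P" "y \<in> V" using A by auto
    let ?c = "cycle_of_list (sorted_list_of_set V)"
    have "finite V" using V A fin by (metis Union_upper finite_subset)
    then have c: "?c permutes V" using cycle_permutes[of "sorted_list_of_set V"] by simp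
    then have "inv ?c y \<in> V" "?c (inv ?c y) = y"
      using V by (auto simp: permutes_inverses permutes_in_image permutes_inv)
    then have "perm_of_partition P (inv ?c y) = y" "inv ?c y \<in> A"
      using perm_of_partition_apply[OF P V(1)] V A by auto
    then show "y \<in> perm_of_partition P ` A" by (metis imageI)
  qed
  then show "bij_betw (perm_of_partition P) A A"
    unfolding bij_betw_def using fin by (simp add: eq_card_imp_inj_on)
qed

section \<open>Cycles of a permutation as a partition\<close>

lemma orbit_eq:
  assumes "\<alpha> permutes A" "finite A" "y \<in> orbit \<alpha> x"
  shows "orbit \<alpha> y = orbit \<alpha> x"
  using orbit_cyclic_eq3[OF cyclic_on_orbit[OF assms(1,2)] assms(3)] .

lemma self_in_orbit:
  assumes "\<alpha> permutes A" "finite A"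
  shows "x \<in> orbit \<alpha> x"
proof -
  have "permutation \<alpha>" using assms by (auto simp: permutation_permutes)
  then show ?thesis by (rule permutation_self_in_orbit)
qed

lemma partition_on_cycles_of:
  assumes "\<alpha> permutes {1..n}"
  shows "partition_on {1..n} (cycles_of n \<alpha>)"
  unfolding partition_on_def cycles_of_def
proof (intro conjI disjointI)
  show "\<Union> (orbit \<alpha> ` {1..n}) = {1..n}"
    using permutes_orbit_subset[OF assms] self_in_orbit[OF assms finite_atLeastAtMost] by blast
  show "{} \<notin> orbit \<alpha> ` {1..n}"
    using orbit_nonempty by (metis imageE)
  fix V W assume "V \<in> orbit \<alpha> ` {1..n}" "W \<in> orbit \<alpha> ` {1..n}" "V \<noteq> W"
  then show "V \<inter> W = {}"
    using orbit_eq[OF assms finite_atLeastAtMost] by blast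
qed

text \<open>An intrinsic description of the image of \<open>perm_of_partition\<close>, in terms of
  orbits alone.\<close>

definition increasing_cycles :: "nat \<Rightarrow> (nat \<Rightarrow> nat) \<Rightarrow> bool" where
  "increasing_cycles n \<alpha> \<longleftrightarrow>
     \<alpha> permutes {1..n} \<and> (\<forall>x\<in>{1..n}. \<alpha> x = succ_in (orbit \<alpha> x) x)"

lemma cycles_of_perm_of_partition:
  assumes P: "partition_on {1..n} P"
  shows "cycles_of n (perm_of_partition P) = P"
proof -
  have *: "{1..n} = \<Union>P" using partition_onD1[OF P] .
  show ?thesis
    unfolding cycles_of_def
  proof (intro equalityI subsetI)
    fix V assume "V \<in> orbit (perm_of_partition P) ` {1..n}"
    then obtain x W where "W \<in> P" "x \<in> W" "V = orbit (perm_of_partition P) x"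
      using * by auto
    then show "V \<in> P" using orbit_perm_of_partition[OF P] by simp
  next
    fix V assume V: "V \<in> P"
    then obtain x where "x \<in> V" using partition_onD3[OF P] by (metis all_not_in_conv)
    then show "V \<in> orbit (perm_of_partition P) ` {1..n}"
      using orbit_perm_of_partition[OF P finite_atLeastAtMost V, of x] V * by auto
  qed
qed

lemma increasing_cycles_perm_of_partition:
  assumes P: "partition_on {1..n} P"
  shows "increasing_cycles n (perm_of_partition P)"
  unfolding increasing_cycles_def
proof (intro conjI ballI)
  show "perm_of_partition P permutes {1..n}"
    using perm_of_partition_permutes[OF P] by simp
  fix x assume "x \<in> {1..n}"
  then obtain V where "V \<in> P" "x \<in> V" using partition_onD1[OF P] by blast
  then show "perm_of_partition P x = succ_in (orbit (perm_of_partition P) x) x"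
    using perm_of_partition_succ_in[OF P] orbit_perm_of_partition[OF P] by simp
qed

lemma perm_of_partition_cycles_of:
  assumes "increasing_cycles n \<alpha>"
  shows "perm_of_partition (cycles_of n \<alpha>) = \<alpha>"
proof
  fix x
  have p: "\<alpha> permutes {1..n}" using assms by (simp add: increasing_cycles_def)
  note P = partition_on_cycles_of[OF p]
  show "perm_of_partition (cycles_of n \<alpha>) x = \<alpha> x"
  proof (cases "x \<in> {1..n}")
    case True
    have "orbit \<alpha> x \<in> cycles_of n \<alpha>" using True by (simp add: cycles_of_def)
    from perm_of_partition_succ_in[OF P finite_atLeastAtMost this self_in_orbit[OF p finite_atLeastAtMost]]
    show ?thesis using assms True by (simp add: increasing_cycles_def)
  next
    case False
    then show ?thesis
      using p partition_onD1[OF P] by (auto simp: perm_of_partition_def permutes_not_in)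
  qed
qed

text \<open>\<open>perm_of_partition\<close> and \<open>cycles_of n\<close> are mutually inverse
  between partitions and permutations with increasing cycles. The predicate \<open>Q\<close> is
  arbitrary so that \<open>NC\<close> and \<open>IntP\<close> are treated at once.\<close>

lemma image_perm_of_partition_iff:
  "\<alpha> \<in> perm_of_partition ` {P. partition_on {1..n} P \<and> Q P} \<longleftrightarrow>
     increasing_cycles n \<alpha> \<and> Q (cycles_of n \<alpha>)"
proof
  assume "\<alpha> \<in> perm_of_partition ` {P. partition_on {1..n} P \<and> Q P}"
  then show "increasing_cycles n \<alpha> \<and> Q (cycles_of n \<alpha>)"
  proof (elim imageE CollectE conjE)
    fix P assume "\<alpha> = perm_of_partition P" "partition_on {1..n} P" "Q P"
    then show ?thesis
      by (simp add: increasing_cycles_perm_of_partition cycles_of_perm_of_partition)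
  qed
next
  assume *: "increasing_cycles n \<alpha> \<and> Q (cycles_of n \<alpha>)"
  then have "partition_on {1..n} (cycles_of n \<alpha>)"
    using partition_on_cycles_of by (simp add: increasing_cycles_def)
  then have "cycles_of n \<alpha> \<in> {P. partition_on {1..n} P \<and> Q P}" using * by simp
  moreover have "\<alpha> = perm_of_partition (cycles_of n \<alpha>)"
    using * perm_of_partition_cycles_of by simp
  ultimately show "\<alpha> \<in> perm_of_partition ` {P. partition_on {1..n} P \<and> Q P}"
    by (rule rev_image_eqI)
qed

text \<open>A block is an interval iff it is convex, and then it runs from its minimum to its
  maximum. Quantifying over points instead of blocks lets the condition be split along a
  concatenation.\<close>

lemma IntP_iff:
  "\<alpha> \<in> IntP n \<longleftrightarrow> increasing_cycles n \<alpha> \<and>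
     (\<forall>a\<in>{1..n}. \<forall>c\<in>orbit \<alpha> a. {a..c} \<subseteq> orbit \<alpha> a)"
proof -
  have "(\<forall>V\<in>cycles_of n \<alpha>. \<exists>i j. V = {i..j}) \<longleftrightarrow>
      (\<forall>a\<in>{1..n}. \<forall>c\<in>orbit \<alpha> a. {a..c} \<subseteq> orbit \<alpha> a)" if p: "\<alpha> permutes {1..n}"
  proof (intro iffI ballI)
    note self = self_in_orbit[OF p finite_atLeastAtMost]
    fix a c assume *: "\<forall>V\<in>cycles_of n \<alpha>. \<exists>i j. V = {i..j}" "a \<in> {1..n}" "c \<in> orbit \<alpha> a"
    then obtain i j where "orbit \<alpha> a = {i..j}" unfolding cycles_of_def by blast
    then show "{a..c} \<subseteq> orbit \<alpha> a" using * self[of a] by auto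
  next
    note self = self_in_orbit[OF p finite_atLeastAtMost]
    fix V assume *: "\<forall>a\<in>{1..n}. \<forall>c\<in>orbit \<alpha> a. {a..c} \<subseteq> orbit \<alpha> a" "V \<in> cycles_of n \<alpha>"
    then obtain x where x: "x \<in> {1..n}" "V = orbit \<alpha> x" by (auto simp: cycles_of_def)
    have sub: "V \<subseteq> {1..n}" using x permutes_orbit_subset[OF p] by blast
    then have fin: "finite V" using finite_subset by blast
    have ne: "V \<noteq> {}" using x orbit_nonempty by simp
    have mem: "Min V \<in> V" "Max V \<in> V" using fin ne by auto
    then have "orbit \<alpha> (Min V) = V"
      using orbit_eq[OF p finite_atLeastAtMost] x by simp
    then have "{Min V..Max V} \<subseteq> V" using * mem sub by (metis subsetD)
    moreover have "V \<subseteq> {Min V..Max V}" using fin by auto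
    ultimately have "V = {Min V..Max V}" by blast
    then show "\<exists>i j. V = {i..j}" by blast
  qed
  then show ?thesis
    unfolding IntP_def image_perm_of_partition_iff increasing_cycles_def by blast
qed

text \<open>Blocks are replaced by the orbits of \<open>a\<close> and \<open>b\<close>; equality of
  two blocks then amounts to \<open>b\<close> lying in the orbit of \<open>a\<close>.\<close>

lemma NC_iff:
  "\<alpha> \<in> NC n \<longleftrightarrow> increasing_cycles n \<alpha> \<and>
     (\<forall>a\<in>{1..n}. \<forall>b\<in>{1..n}. \<forall>c\<in>orbit \<alpha> a. \<forall>d\<in>orbit \<alpha> b.
        a < b \<and> b < c \<and> c < d \<longrightarrow> b \<in> orbit \<alpha> a)"
proof -
  have "noncrossing (cycles_of n \<alpha>) \<longleftrightarrow>
      (\<forall>a\<in>{1..n}. \<forall>b\<in>{1..n}. \<forall>c\<in>orbit \<alpha> a. \<forall>d\<in>orbit \<alpha> b.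
        a < b \<and> b < c \<and> c < d \<longrightarrow> b \<in> orbit \<alpha> a)" if p: "\<alpha> permutes {1..n}"
  proof (intro iffI ballI impI)
    note self = self_in_orbit[OF p finite_atLeastAtMost]
    fix a b c d assume *: "noncrossing (cycles_of n \<alpha>)" "a \<in> {1..n}" "b \<in> {1..n}"
      "c \<in> orbit \<alpha> a" "d \<in> orbit \<alpha> b" "a < b \<and> b < c \<and> c < d"
    then have "orbit \<alpha> a = orbit \<alpha> b"
      unfolding noncrossing_def cycles_of_def using self by blast
    then show "b \<in> orbit \<alpha> a" using self by simp
  next
    assume *: "\<forall>a\<in>{1..n}. \<forall>b\<in>{1..n}. \<forall>c\<in>orbit \<alpha> a. \<forall>d\<in>orbit \<alpha> b.
        a < b \<and> b < c \<and> c < d \<longrightarrow> b \<in> orbit \<alpha> a"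
    show "noncrossing (cycles_of n \<alpha>)"
      unfolding noncrossing_def
    proof (intro ballI impI)
      fix V W a b c d
      assume h: "V \<in> cycles_of n \<alpha>" "W \<in> cycles_of n \<alpha>" "a \<in> V" "b \<in> W" "c \<in> V" "d \<in> W"
        "a < b \<and> b < c \<and> c < d"
      then have ab: "V = orbit \<alpha> a" "W = orbit \<alpha> b" "a \<in> {1..n}" "b \<in> {1..n}"
        using orbit_eq[OF p finite_atLeastAtMost] partition_onD1[OF partition_on_cycles_of[OF p]]
        by (auto simp: cycles_of_def)
      then have "b \<in> orbit \<alpha> a" using * h by blast
      then show "V = W" using ab orbit_eq[OF p finite_atLeastAtMost] by simp
    qed
  qed
  then show ?thesis
    unfolding NC_def image_perm_of_partition_iff increasing_cycles_def by blast
qed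

subsection \<open>Concatenation of permutations\<close>

text \<open>The direct sum of permutations. The size of the right part is not a parameter because
  \<open>\<beta>\<close> fixes all points beyond it; the point 0 falls into the left branch.\<close>

definition cat :: "nat \<Rightarrow> (nat \<Rightarrow> nat) \<Rightarrow> (nat \<Rightarrow> nat) \<Rightarrow> nat \<Rightarrow> nat" where
  "cat k \<alpha> \<beta> x = (if x \<le> k then \<alpha> x else \<beta> (x - k) + k)"

text \<open>Inclusion already means equality here when \<open>\<alpha>\<close> is injective. The
  value 0 is left out, while \<open>n\<close> is included for every permutation of
  \<open>{1..n}\<close> with \<open>1 \<le> n\<close>.\<close>

definition splits :: "nat \<Rightarrow> (nat \<Rightarrow> nat) \<Rightarrow> nat set" where
  "splits n \<alpha> = {d \<in> {1..n}. \<alpha> ` {1..d} \<subseteq> {1..d}}"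

lemma permutes_le:
  fixes k :: nat
  assumes "\<alpha> permutes {1..k}" "x \<le> k"
  shows "\<alpha> x \<le> k"
  using assms permutes_in_image[OF assms(1), of x] permutes_not_in[OF assms(1), of x]
  by (cases "x \<in> {1..k}") auto

lemma permutes_gr_0:
  fixes k :: nat
  assumes "\<alpha> permutes {1..k}" "0 < x"
  shows "0 < \<alpha> x"
  using assms permutes_in_image[OF assms(1), of x] permutes_not_in[OF assms(1), of x]
  by (cases "x \<in> {1..k}") auto

lemma ball_atLeastAtMost_add:
  fixes k m :: nat
  shows "(\<forall>x\<in>{1..k + m}. P x) \<longleftrightarrow> (\<forall>x\<in>{1..k}. P x) \<and> (\<forall>y\<in>{1..m}. P (y + k))"
proof -
  have "{1..k + m} = {1..k} \<union> (\<lambda>y. y + k) ` {1..m}"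
    by (auto simp: image_add_atLeastAtMost')
  then show ?thesis by (simp only: ball_Un ball_simps)
qed

text \<open>The inner factors keep the points up to \<open>k\<close> and those beyond
  \<open>k\<close> apart, so the outer case distinction is decided by the inner one.\<close>

lemma cat_comp:
  assumes "\<alpha>' permutes {1..k}" "\<beta>' permutes {1..m}"
  shows "cat k \<alpha> \<beta> \<circ> cat k \<alpha>' \<beta>' = cat k (\<alpha> \<circ> \<alpha>') (\<beta> \<circ> \<beta>')"
proof
  fix x
  show "(cat k \<alpha> \<beta> \<circ> cat k \<alpha>' \<beta>') x = cat k (\<alpha> \<circ> \<alpha>') (\<beta> \<circ> \<beta>') x"
    using permutes_le[OF assms(1), of x] permutes_gr_0[OF assms(2), of "x - k"]
    by (cases "x \<le> k") (simp_all add: cat_def)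
qed

lemma cat_id: "cat k id id = id"
  by (auto simp: cat_def fun_eq_iff)

context
  fixes k m :: nat and \<alpha> \<beta> :: "nat \<Rightarrow> nat"
  assumes \<alpha>: "\<alpha> permutes {1..k}" and \<beta>: "\<beta> permutes {1..m}"
begin

lemma inv_cat: "inv (cat k \<alpha> \<beta>) = cat k (inv \<alpha>) (inv \<beta>)"
  and cat_permutes: "cat k \<alpha> \<beta> permutes {1..k + m}"
proof -
  have inverses: "cat k \<alpha> \<beta> \<circ> cat k (inv \<alpha>) (inv \<beta>) = id"
    "cat k (inv \<alpha>) (inv \<beta>) \<circ> cat k \<alpha> \<beta> = id"
    using cat_comp[OF permutes_inv[OF \<alpha>] permutes_inv[OF \<beta>]] cat_comp[OF \<alpha> \<beta>]
    by (simp_all add: permutes_inv_o[OF \<alpha>] permutes_inv_o[OF \<beta>] cat_id)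
  then show "inv (cat k \<alpha> \<beta>) = cat k (inv \<alpha>) (inv \<beta>)"
    by (rule inv_unique_comp)
  have "bij (cat k \<alpha> \<beta>)" using inverses(2,1) by (rule o_bij)
  moreover have "cat k \<alpha> \<beta> x = x" if "x \<notin> {1..k + m}" for x
  proof (cases "x \<le> k")
    case True
    then have "x \<notin> {1..k}" using that by auto
    then show ?thesis using True permutes_not_in[OF \<alpha>] by (simp add: cat_def)
  next
    case False
    then have "x - k \<notin> {1..m}" using that by auto
    then show ?thesis using False permutes_not_in[OF \<beta>] by (simp add: cat_def)
  qed
  ultimately show "cat k \<alpha> \<beta> permutes {1..k + m}"
    by (simp add: permutes_def bij_iff)
qed

lemma orbit_cat_left:
  assumes "x \<le> k"
  shows "orbit (cat k \<alpha> \<beta>) x = orbit \<alpha> x"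
proof (rule orbit_cong0[of _ "{..k}"])
  show "cat k \<alpha> \<beta> \<in> {..k} \<rightarrow> {..k}"
    using permutes_le[OF \<alpha>] by (auto simp: cat_def)
qed (use assms in \<open>auto simp: cat_def\<close>)

text \<open>The shift by \<open>k\<close> intertwines \<open>\<beta>\<close> with the concatenation
  on positive arguments, and an orbit that starts at a positive point stays positive.\<close>

lemma orbit_cat_right:
  assumes "0 < x"
  shows "orbit (cat k \<alpha> \<beta>) (x + k) = (\<lambda>y. y + k) ` orbit \<beta> x"
proof (rule orbit_inverse[symmetric])
  show "x \<in> orbit \<beta> x" using self_in_orbit[OF \<beta>] by simp
  fix y assume "y \<in> orbit \<beta> x"
  then have "0 < y" using assms by induct (auto simp: permutes_gr_0[OF \<beta>])
  then show "cat k \<alpha> \<beta> (y + k) = \<beta> y + k" by (simp add: cat_def)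
qed

lemma cycles_of_cat:
  "cycles_of (k + m) (cat k \<alpha> \<beta>) = cycles_of k \<alpha> \<union> (`) (\<lambda>y. y + k) ` cycles_of m \<beta>"
proof -
  have "{1..k + m} = {1..k} \<union> (\<lambda>y. y + k) ` {1..m}"
    by (auto simp: image_add_atLeastAtMost')
  moreover have "orbit (cat k \<alpha> \<beta>) ` {1..k} = cycles_of k \<alpha>"
    unfolding cycles_of_def by (intro image_cong) (auto simp: orbit_cat_left)
  moreover have "orbit (cat k \<alpha> \<beta>) ` (\<lambda>y. y + k) ` {1..m} = (`) (\<lambda>y. y + k) ` cycles_of m \<beta>"
    unfolding cycles_of_def image_image by (intro image_cong) (auto simp: orbit_cat_right)
  ultimately show ?thesis unfolding cycles_of_def by (simp only: image_Un)
qed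

lemma cycles_of_cat_disjoint:
  "cycles_of k \<alpha> \<inter> (`) (\<lambda>y. y + k) ` cycles_of m \<beta> = {}"
proof (intro equalityI subsetI)
  fix V assume "V \<in> cycles_of k \<alpha> \<inter> (`) (\<lambda>y. y + k) ` cycles_of m \<beta>"
  then obtain W where V: "V \<in> cycles_of k \<alpha>" "V = (\<lambda>y. y + k) ` W" "W \<in> cycles_of m \<beta>" by blast
  have W: "W \<noteq> {}" "W \<subseteq> {1..m}"
    using V(3) partition_on_cycles_of[OF \<beta>] partition_onD1 partition_onD3 by blast+
  have "V \<subseteq> {1..k}" using V(1) partition_onD1[OF partition_on_cycles_of[OF \<alpha>]] by blast
  then show "V \<in> {}" using W V(2) by fastforce
qed simp

lemma prod_cycles_of_cat:
  fixes f :: "nat set \<Rightarrow> 'a :: comm_monoid_mult"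
  shows "(\<Prod>c\<in>cycles_of (k + m) (cat k \<alpha> \<beta>). f c) =
    (\<Prod>c\<in>cycles_of k \<alpha>. f c) * (\<Prod>c\<in>cycles_of m \<beta>. f ((\<lambda>y. y + k) ` c))"
proof -
  have inj: "inj_on ((`) (\<lambda>y. y + k)) (cycles_of m \<beta>)"
    by (intro inj_on_image) (simp add: inj_on_def)
  have "(\<Prod>c\<in>cycles_of (k + m) (cat k \<alpha> \<beta>). f c) =
      (\<Prod>c\<in>cycles_of k \<alpha>. f c) * (\<Prod>c\<in>(`) (\<lambda>y. y + k) ` cycles_of m \<beta>. f c)"
    unfolding cycles_of_cat
    by (intro prod.union_disjoint cycles_of_cat_disjoint) (simp_all add: cycles_of_def)
  then show ?thesis by (simp add: prod.reindex[OF inj])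
qed

lemma perm_norm_cat: "perm_norm (k + m) (cat k \<alpha> \<beta>) = perm_norm k \<alpha> + perm_norm m \<beta>"
proof -
  have inj: "inj_on ((`) (\<lambda>y. y + k)) (cycles_of m \<beta>)"
    by (intro inj_on_image) (simp add: inj_on_def)
  have fin: "finite (cycles_of i \<pi>)" for i \<pi> by (simp add: cycles_of_def)
  \<comment> \<open>The norm is a truncated difference, so its additivity rests on this
    bound.\<close>
  have le: "card (cycles_of i \<pi>) \<le> i" for i \<pi>
    using card_image_le[of "{1..i}" "orbit \<pi>"] by (simp add: cycles_of_def)
  have "card (cycles_of (k + m) (cat k \<alpha> \<beta>)) = card (cycles_of k \<alpha>) + card (cycles_of m \<beta>)"
    unfolding cycles_of_cat
    by (simp add: card_Un_disjoint fin cycles_of_cat_disjoint card_image[OF inj])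
  then show ?thesis using le[of k \<alpha>] le[of m \<beta>] by (simp add: perm_norm_def)
qed

text \<open>Splitting at \<open>d\<close> concerns only the values on \<open>{1..d}\<close>, which
  come from the left part. Hence the first splitting points can be controlled by the left parts
  alone.\<close>

lemma mem_splits_cat:
  assumes "d \<le> k"
  shows "d \<in> splits (k + m) (cat k \<alpha> \<beta>) \<longleftrightarrow> d \<in> splits k \<alpha>"
proof -
  have "cat k \<alpha> \<beta> ` {1..d} = \<alpha> ` {1..d}"
    using assms by (intro image_cong) (auto simp: cat_def)
  then show ?thesis using assms by (auto simp: splits_def)
qed

lemma increasing_cycles_cat_iff:
  "increasing_cycles (k + m) (cat k \<alpha> \<beta>) \<longleftrightarrow> increasing_cycles k \<alpha> \<and> increasing_cycles m \<beta>"
proof -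
  have left: "cat k \<alpha> \<beta> x = succ_in (orbit (cat k \<alpha> \<beta>) x) x \<longleftrightarrow> \<alpha> x = succ_in (orbit \<alpha> x) x"
    if "x \<le> k" for x
    using that by (simp add: orbit_cat_left) (simp add: cat_def)
  have right: "cat k \<alpha> \<beta> (y + k) = succ_in (orbit (cat k \<alpha> \<beta>) (y + k)) (y + k) \<longleftrightarrow>
      \<beta> y = succ_in (orbit \<beta> y) y" if "0 < y" for y
    using that self_in_orbit[OF \<beta>]
    by (simp add: orbit_cat_right succ_in_image_add) (simp add: cat_def)
  show ?thesis
    unfolding increasing_cycles_def ball_atLeastAtMost_add
    using \<alpha> \<beta> cat_permutes left right by simp
qed

lemma IntP_cat_iff: "cat k \<alpha> \<beta> \<in> IntP (k + m) \<longleftrightarrow> \<alpha> \<in> IntP k \<and> \<beta> \<in> IntP m"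
proof -
  let ?Q = "\<lambda>\<pi> a. \<forall>c\<in>orbit \<pi> a. {a..c} \<subseteq> orbit \<pi> a"
  have left: "?Q (cat k \<alpha> \<beta>) a \<longleftrightarrow> ?Q \<alpha> a" if "a \<le> k" for a
    using that by (simp add: orbit_cat_left)
  have right: "?Q (cat k \<alpha> \<beta>) (a + k) \<longleftrightarrow> ?Q \<beta> a" if "0 < a" for a
  proof -
    have *: "{a + k..c + k} \<subseteq> (\<lambda>y. y + k) ` V \<longleftrightarrow> {a..c} \<subseteq> V" for c V
      using inj_image_subset_iff[of "\<lambda>y. y + k" "{a..c}" V]
      by (simp add: image_add_atLeastAtMost' inj_def)
    show ?thesis using that by (simp add: orbit_cat_right *)
  qed
  show ?thesis
    unfolding IntP_iff increasing_cycles_cat_iff ball_atLeastAtMost_add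
    using left right by auto
qed

lemma NC_cat_iff: "cat k \<alpha> \<beta> \<in> NC (k + m) \<longleftrightarrow> \<alpha> \<in> NC k \<and> \<beta> \<in> NC m"
proof -
  let ?Q = "\<lambda>\<pi> a b. \<forall>c\<in>orbit \<pi> a. \<forall>d\<in>orbit \<pi> b. a < b \<and> b < c \<and> c < d \<longrightarrow> b \<in> orbit \<pi> a"
  have sub: "orbit \<alpha> a \<subseteq> {1..k}" if "a \<in> {1..k}" for a
    using permutes_orbit_subset[OF \<alpha> that] .
  have left: "?Q (cat k \<alpha> \<beta>) a b \<longleftrightarrow> ?Q \<alpha> a b" if "a \<in> {1..k}" "b \<in> {1..k}" for a b
    using that by (simp add: orbit_cat_left)
  have right: "?Q (cat k \<alpha> \<beta>) (a + k) (b + k) \<longleftrightarrow> ?Q \<beta> a b" if "a \<in> {1..m}" "b \<in> {1..m}" for a b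
  proof -
    have "0 < a" "0 < b" using that by auto
    then show ?thesis by (auto simp: orbit_cat_right)
  qed
  \<comment> \<open>Points from different halves never cross: the orbit of \<open>a\<close> stays
    below \<open>b + k\<close> here, and in the next case the order \<open>a < b\<close>
    fails.\<close>
  have left_right: "?Q (cat k \<alpha> \<beta>) a (b + k)" if "a \<in> {1..k}" for a b
    using that sub[of a] by (fastforce simp: orbit_cat_left)
  have right_left: "?Q (cat k \<alpha> \<beta>) (a + k) b" if "b \<in> {1..k}" for a b
    using that by auto
  define S where "S \<pi> a b = ?Q \<pi> a b" for \<pi> and a b :: nat
  have "(\<forall>a\<in>{1..k+m}. \<forall>b\<in>{1..k+m}. S (cat k \<alpha> \<beta>) a b) \<longleftrightarrow>
      (\<forall>a\<in>{1..k}. \<forall>b\<in>{1..k}. S \<alpha> a b) \<and> (\<forall>a\<in>{1..m}. \<forall>b\<in>{1..m}. S \<beta> a b)"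
    using left right left_right right_left
    unfolding ball_atLeastAtMost_add S_def[symmetric] by simp
  then have eq: "(\<forall>a\<in>{1..k+m}. \<forall>b\<in>{1..k+m}. ?Q (cat k \<alpha> \<beta>) a b) \<longleftrightarrow>
      (\<forall>a\<in>{1..k}. \<forall>b\<in>{1..k}. ?Q \<alpha> a b) \<and> (\<forall>a\<in>{1..m}. \<forall>b\<in>{1..m}. ?Q \<beta> a b)"
    unfolding S_def .
  show ?thesis
    unfolding NC_iff increasing_cycles_cat_iff eq by (simp only: conj_ac)
qed

end

lemma cat_inject:
  assumes "\<beta> permutes {1..m}" "\<beta>' permutes {1..m'}" "\<alpha> permutes {1..k}" "\<alpha>' permutes {1..k}"
    and eq: "cat k \<alpha> \<beta> = cat k \<alpha>' \<beta>'"
  shows "\<alpha> = \<alpha>' \<and> \<beta> = \<beta>'"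
proof (intro conjI ext)
  fix x
  show "\<alpha> x = \<alpha>' x"
    using fun_cong[OF eq, of x] permutes_not_in[OF assms(3), of x] permutes_not_in[OF assms(4), of x]
    by (cases "x \<le> k") (auto simp: cat_def)
  \<comment> \<open>The concatenation uses the right part at positive arguments only; at 0 both
    right parts are the identity.\<close>
  show "\<beta> x = \<beta>' x"
    using fun_cong[OF eq, of "x + k"] permutes_not_in[OF assms(1), of 0] permutes_not_in[OF assms(2), of 0]
    by (cases "x = 0") (auto simp: cat_def)
qed

text \<open>An injective map that preserves the finite set \<open>{1..k}\<close> maps it onto
  itself, so it also preserves the points beyond \<open>k\<close>. The two restrictions, the second
  one shifted back, are the required parts.\<close>

lemma cat_exists:
  assumes \<gamma>: "\<gamma> permutes {1..k + m}" and k: "\<gamma> ` {1..k} \<subseteq> {1..k}"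
  obtains \<alpha> \<beta> where "\<alpha> permutes {1..k}" "\<beta> permutes {1..m}" "\<gamma> = cat k \<alpha> \<beta>"
proof
  have inj: "inj \<gamma>" using permutes_inj[OF \<gamma>] .
  have im: "\<gamma> ` {1..k} = {1..k}"
    using endo_inj_surj[OF _ k] inj by (simp add: inj_on_def)
  have le: "\<gamma> x \<le> k" if "x \<le> k" for x
  proof (cases "x = 0")
    case True
    then show ?thesis using permutes_not_in[OF \<gamma>, of x] by simp
  next
    case False
    then have "x \<in> {1..k}" using that by simp
    then have "\<gamma> x \<in> {1..k}" using k by blast
    then show ?thesis by simp
  qed
  have gr: "k < \<gamma> x" if "k < x" for x
  proof (rule ccontr)
    assume "\<not> k < \<gamma> x"
    moreover have "0 < \<gamma> x" using permutes_gr_0[OF \<gamma>] that by simp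
    ultimately have "\<gamma> x \<in> \<gamma> ` {1..k}" unfolding im by simp
    then have "x \<in> {1..k}" using inj by (simp only: inj_image_mem_iff)
    then show False using that by simp
  qed
  show "(\<lambda>x. if x \<le> k then \<gamma> x else x) permutes {1..k}" (is "?\<alpha> permutes _")
  proof (rule bij_imp_permutes)
    have "bij_betw \<gamma> {1..k} {1..k}"
      using im inj by (simp add: bij_betw_def inj_on_def)
    then show "bij_betw ?\<alpha> {1..k} {1..k}"
      by (rule bij_betw_cong[THEN iffD1, rotated]) simp
    show "?\<alpha> x = x" if "x \<notin> {1..k}" for x
      using that permutes_not_in[OF \<gamma>, of 0] by (cases "x = 0") auto
  qed
  show "(\<lambda>y. \<gamma> (y + k) - k) permutes {1..m}" (is "?\<beta> permutes _")
  proof (rule bij_imp_permutes)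
    have "?\<beta> ` {1..m} \<subseteq> {1..m}"
    proof clarify
      fix y assume "y \<in> {1..m}"
      then show "?\<beta> y \<in> {1..m}"
        using gr[of "y + k"] permutes_le[OF \<gamma>, of "y + k"] by auto
    qed
    moreover have "inj_on ?\<beta> {1..m}"
    proof (rule inj_onI)
      fix y z assume "y \<in> {1..m}" "z \<in> {1..m}" "?\<beta> y = ?\<beta> z"
      then have "\<gamma> (y + k) = \<gamma> (z + k)" using gr[of "y + k"] gr[of "z + k"] by simp
      then show "y = z" using injD[OF inj, of "y + k" "z + k"] by simp
    qed
    ultimately show "bij_betw ?\<beta> {1..m} {1..m}"
      by (simp add: bij_betw_def endo_inj_surj)
    \<comment> \<open>At \<open>y = 0\<close> the truncated difference vanishes because
      \<open>\<gamma> k \<le> k\<close>.\<close>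
    show "?\<beta> y = y" if "y \<notin> {1..m}" for y
      using that le[of k] permutes_not_in[OF \<gamma>, of "y + k"] by (cases "y = 0") auto
  qed
  show "\<gamma> = cat k ?\<alpha> ?\<beta>"
    using gr by (auto simp: cat_def fun_eq_iff less_imp_le)
qed

section \<open>Invariance of the norm under inversion and conjugation\<close>

lemma perm_norm_inv:
  assumes "\<pi> permutes {1..n}"
  shows "perm_norm n (inv \<pi>) = perm_norm n \<pi>"
proof -
  have "permutation \<pi>" using assms by (auto simp: permutation_permutes)
  then show ?thesis by (simp add: perm_norm_def cycles_of_def orbit_inv_eq)
qed

lemma perm_norm_conj:
  assumes \<pi>: "\<pi> permutes {1..n}" and g: "g permutes {1..n}"
  shows "perm_norm n (g \<circ> \<pi> \<circ> inv g) = perm_norm n \<pi>"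
proof -
  have orbit: "orbit (g \<circ> \<pi> \<circ> inv g) (g x) = g ` orbit \<pi> x" for x
    by (rule orbit_inverse[symmetric])
      (simp_all add: self_in_orbit[OF \<pi>] permutes_inverses(2)[OF g])
  have "cycles_of n (g \<circ> \<pi> \<circ> inv g) = orbit (g \<circ> \<pi> \<circ> inv g) ` g ` {1..n}"
    by (simp only: cycles_of_def permutes_image[OF g])
  also have "\<dots> = (`) g ` cycles_of n \<pi>"
    unfolding cycles_of_def image_image orbit ..
  finally have "card (cycles_of n (g \<circ> \<pi> \<circ> inv g)) = card (cycles_of n \<pi>)"
    using inj_on_image[of g "cycles_of n \<pi>"] permutes_inj_on[OF g]
    by (simp add: card_image)
  then show ?thesis by (simp add: perm_norm_def)
qed

subsection \<open>Splitting points and Kreweras complements\<close>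

lemma succ_in_between:
  assumes "y \<in> V" "x < y"
  shows "x < succ_in V x" "succ_in V x \<le> y"
proof -
  have "\<exists>y. y \<in> V \<and> x < y" using assms by blast
  from LeastI_ex[OF this] show "x < succ_in V x" using assms by (auto simp: succ_in_def)
  have "(LEAST y. y \<in> V \<and> x < y) \<le> y" using assms by (intro Least_le) simp
  then show "succ_in V x \<le> y" using assms by (auto simp: succ_in_def)
qed

lemma orbit_subset_splits:
  assumes "d \<in> splits n \<alpha>" "x \<in> {1..d}"
  shows "orbit \<alpha> x \<subseteq> {1..d}"
proof
  have step: "\<alpha> y \<in> {1..d}" if "y \<in> {1..d}" for y
    using assms(1) that unfolding splits_def by blast
  fix y assume "y \<in> orbit \<alpha> x"
  then show "y \<in> {1..d}" by induct (simp_all only: step assms(2))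
qed

lemma splits_subset: "splits n \<alpha> \<subseteq> {1..n}"
  by (auto simp: splits_def)

lemma splits_bounds:
  assumes "d \<in> splits n \<alpha>"
  shows "1 \<le> d" "d \<le> n"
  using assms by (auto simp: splits_def)

lemma n_mem_splits:
  assumes "\<alpha> permutes {1..n}" "1 \<le> n"
  shows "n \<in> splits n \<alpha>"
  using assms permutes_image[OF assms(1)] by (simp add: splits_def)

lemma NC_permutes: "\<alpha> \<in> NC n \<Longrightarrow> \<alpha> permutes {1..n}"
  by (simp add: NC_iff increasing_cycles_def)

lemma IntP_NC: "\<alpha> \<in> IntP n \<Longrightarrow> \<alpha> \<in> NC n"
  using IntP_subset_NC by (rule subsetD)

lemma IntP_permutes: "\<alpha> \<in> IntP n \<Longrightarrow> \<alpha> permutes {1..n}"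
  by (rule NC_permutes[OF IntP_NC])

section \<open>The full cycle and the Kreweras map\<close>

lemma full_cycle_permutes: "full_cycle n permutes {1..n}"
proof -
  have "set [1..<Suc n] = {1..n}" by auto
  then show ?thesis unfolding full_cycle_def by (metis cycle_permutes)
qed

lemma full_cycle_eq: "full_cycle n = cycle_of_list (sorted_list_of_set {1..n})"
proof -
  have "sorted_list_of_set {1..n} = [1..<Suc n]"
    using sorted_list_of_set_range[of 1 "Suc n"] by (simp only: atLeastLessThanSuc_atLeastAtMost)
  then show ?thesis by (simp only: full_cycle_def)
qed

lemma full_cycle_apply:
  assumes "1 \<le> x" "x \<le> n"
  shows "full_cycle n x = (if x = n then 1 else Suc x)"
proof -
  have *: "full_cycle n x = succ_in {1..n} x"
    unfolding full_cycle_eq by (rule cycle_of_sorted_list(1)) (use assms in simp_all)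
  show ?thesis
  proof (cases "x = n")
    case True
    then have "succ_in {1..n} x = (LEAST y. y \<in> {1..n})" by (auto simp: succ_in_def)
    also have "\<dots> = 1" using assms by (intro Least_equality) auto
    finally show ?thesis using * True by simp
  next
    case False
    then have "x < succ_in {1..n} x" "succ_in {1..n} x \<le> Suc x"
      using succ_in_between[of "Suc x" "{1..n}" x] assms by auto
    then show ?thesis using * False by simp
  qed
qed

lemma kreweras_permutes:
  assumes "\<alpha> permutes {1..n}"
  shows "kreweras n \<alpha> permutes {1..n}"
  unfolding kreweras_def by (intro permutes_compose full_cycle_permutes permutes_inv assms)

lemma kreweras_inject:
  assumes \<alpha>: "\<alpha> permutes {1..n}" and \<beta>: "\<beta> permutes {1..n}"
    and eq: "kreweras n \<alpha> = kreweras n \<beta>"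
  shows "\<alpha> = \<beta>"
proof -
  have "kreweras n \<alpha> \<circ> inv (full_cycle n) = kreweras n \<beta> \<circ> inv (full_cycle n)"
    using eq by simp
  then have "inv \<alpha> = inv \<beta>"
    by (simp only: kreweras_def comp_assoc permutes_inv_o[OF full_cycle_permutes] comp_id)
  then have "inv (inv \<alpha>) = inv (inv \<beta>)" by simp
  then show ?thesis by (simp add: permutes_inv_inv[OF \<alpha>] permutes_inv_inv[OF \<beta>])
qed

text \<open>
  As \<open>Suc e\<close> is the minimum of its block, \<open>inv \<beta>\<close> sends it to the maximum \<open>f\<close>, and a block leaving
  \<open>{1..f}\<close> would cross this one. The value \<open>n\<close> plays the role of \<open>0\<close>, since the
  full cycle sends it to \<open>1\<close>.
\<close>

lemma kreweras_step:
  assumes \<beta>: "\<beta> \<in> NC n" and e: "e \<in> insert 0 (splits n \<beta>)" "e < n"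
  defines "f \<equiv> kreweras n \<beta> (if e = 0 then n else e)"
  shows "f \<in> splits n \<beta>" "e < f" "\<And>d. d \<in> splits n \<beta> \<Longrightarrow> e < d \<Longrightarrow> f \<le> d"
proof -
  have p: "\<beta> permutes {1..n}" using NC_permutes[OF \<beta>] .
  let ?V = "orbit \<beta> (Suc e)"
  have f_eq: "f = inv \<beta> (Suc e)"
    using full_cycle_apply[of "if e = 0 then n else e" n] e(2) by (simp add: f_def kreweras_def)
  have \<beta>f: "\<beta> f = Suc e" unfolding f_eq by (rule permutes_inverses(1)[OF p])
  then have orbit_f: "orbit \<beta> f = ?V"
    using orbit_eq[OF p finite_atLeastAtMost orbit.base[of \<beta> f]] by simp
  then have fV: "f \<in> ?V" using self_in_orbit[OF p, of f] by simp
  have V: "?V \<subseteq> {1..n}" using permutes_orbit_subset[OF p, of "Suc e"] e(2) by simp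
  have V_gr: "e < y" if "y \<in> ?V" for y
  proof (rule ccontr)
    assume "\<not> e < y"
    moreover have "1 \<le> y" using V that by auto
    ultimately have "e \<in> splits n \<beta>" "y \<in> {1..e}" using e(1) by auto
    then have "orbit \<beta> y \<subseteq> {1..e}" by (rule orbit_subset_splits)
    moreover have "Suc e \<in> orbit \<beta> y"
      using orbit_eq[OF p finite_atLeastAtMost that] self_in_orbit[OF p, of "Suc e"] by simp
    ultimately show False by auto
  qed
  have f_n: "f \<in> {1..n}" using V fV by blast
  then have succ: "succ_in ?V f = Suc e"
    using \<beta> \<beta>f orbit_f by (simp add: NC_iff increasing_cycles_def)
  \<comment> \<open>In an increasing cycle only the maximum is not moved up, and \<open>f\<close> is
    sent to \<open>Suc e \<le> f\<close>.\<close>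
  have V_le: "y \<le> f" if "y \<in> ?V" for y
  proof (rule ccontr)
    assume "\<not> y \<le> f"
    then have "f < succ_in ?V f" using succ_in_between[OF that] by simp
    then show False using succ V_gr[OF fV] by simp
  qed
  show ef: "e < f" using V_gr[OF fV] .
  show "f \<le> d" if "d \<in> splits n \<beta>" "e < d" for d
    using orbit_subset_splits[OF that(1), of "Suc e"] that(2) fV by auto
  have "\<beta> x \<le> f" if x: "x \<in> {1..f}" for x
  proof (rule ccontr)
    assume *: "\<not> \<beta> x \<le> f"
    have "\<not> x \<le> e"
    proof
      assume "x \<le> e"
      then have "e \<in> splits n \<beta>" using e(1) x by auto
      then have "\<beta> ` {1..e} \<subseteq> {1..e}" by (simp add: splits_def)
      then have "\<beta> x \<in> {1..e}" using \<open>x \<le> e\<close> x by (auto simp: image_subset_iff)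
      then show False using * ef by simp
    qed
    moreover have "x \<notin> ?V"
      using * V_le orbit.step[of x \<beta> "Suc e"] by auto
    moreover have "x \<noteq> Suc e" using * V_le orbit.base[of \<beta> "Suc e"] by auto
    moreover have "x \<noteq> f" using fV \<open>x \<notin> ?V\<close> by auto
    \<comment> \<open>These points give the forbidden crossing: \<open>Suc e\<close> and
      \<open>f\<close> lie in one block, \<open>x\<close> and \<open>\<beta> x\<close> in
      another.\<close>
    ultimately have "Suc e < x" "x < f" "f < \<beta> x" using x * by auto
    moreover have "Suc e \<in> {1..n}" "x \<in> {1..n}" using e(2) x f_n by auto
    ultimately have "x \<in> ?V"
      using \<beta> fV orbit.base[of \<beta> x] unfolding NC_iff by blast
    then show False using \<open>x \<notin> ?V\<close> by simp
  qed
  moreover have "1 \<le> \<beta> x" if "x \<in> {1..f}" for x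
    using permutes_gr_0[OF p, of x] that by simp
  ultimately have "\<beta> ` {1..f} \<subseteq> {1..f}" by (auto simp: image_subset_iff)
  then show "f \<in> splits n \<beta>" using f_n by (simp add: splits_def)
qed

text \<open>The complement sends each splitting point below \<open>n\<close> to the next one and
  \<open>n\<close> to the first, so iterating from \<open>n\<close> visits exactly the splitting
  points.\<close>

lemma orbit_kreweras:
  assumes \<beta>: "\<beta> \<in> NC n" and n: "1 \<le> n"
  shows "orbit (kreweras n \<beta>) n = splits n \<beta>"
proof (intro equalityI subsetI)
  let ?k = "kreweras n \<beta>"
  have base: "?k n \<in> splits n \<beta>" using kreweras_step(1)[OF \<beta>, of 0] n by simp
  fix y assume "y \<in> orbit ?k n"
  then show "y \<in> splits n \<beta>"
  proof induct
    case base
    then show ?case using \<open>?k n \<in> splits n \<beta>\<close> .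
  next
    case (step y)
    then have "1 \<le> y" "y \<le> n" using splits_bounds by blast+
    then show ?case
      using kreweras_step(1)[OF \<beta>, of y] step base by (cases "y = n") auto
  qed
next
  let ?k = "kreweras n \<beta>"
  note p = kreweras_permutes[OF NC_permutes[OF \<beta>]]
  fix d assume "d \<in> splits n \<beta>"
  then show "d \<in> orbit ?k n"
  proof (induct d rule: less_induct)
    case (less d)
    have d: "1 \<le> d" "d \<le> n" using splits_bounds[OF less(2)] .
    \<comment> \<open>The maximum of \<open>E\<close> is the splitting point just before
      \<open>d\<close>, or 0 if there is none, in which case \<open>n\<close> is the point sent to
      \<open>d\<close>.\<close>
    define E where "E = insert 0 {d' \<in> splits n \<beta>. d' < d}"
    have fin: "finite E" using finite_subset[OF splits_subset] by (simp add: E_def)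
    define e where "e = Max E"
    have "e \<in> E" unfolding e_def using fin by (intro Max_in) (auto simp: E_def)
    then have e: "e \<in> insert 0 (splits n \<beta>)" "e < d" using d by (auto simp: E_def)
    then have "e < n" using d by simp
    let ?f = "?k (if e = 0 then n else e)"
    note step = kreweras_step[OF \<beta> e(1) \<open>e < n\<close>]
    have f_eq: "?f = d"
    proof (rule ccontr)
      assume "?f \<noteq> d"
      then have "?f \<in> E" using step(1) step(3)[OF less(2) e(2)] by (simp add: E_def)
      then have "?f \<le> e" unfolding e_def using fin by simp
      then show False using step(2) by simp
    qed
    have "(if e = 0 then n else e) \<in> orbit ?k n"
      using less(1)[OF e(2)] e(1) self_in_orbit[OF p, of n] by auto
    then have "?f \<in> orbit ?k n" by (rule orbit.step)
    then show ?case by (simp only: f_eq)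
  qed
qed

text \<open>If \<open>x\<close> is not a splitting point, some \<open>y \<le> x\<close> is sent
  beyond \<open>x\<close>. By convexity its block contains \<open>x\<close> and
  \<open>Suc x\<close>, so \<open>\<alpha>\<close> acts at \<open>x\<close> like the full cycle and
  the two cancel.\<close>

lemma kreweras_fixes:
  assumes \<alpha>: "\<alpha> \<in> IntP n" and x: "x \<in> {1..n}" "x \<notin> splits n \<alpha>"
  shows "kreweras n \<alpha> x = x"
proof -
  have p: "\<alpha> permutes {1..n}" using IntP_permutes[OF \<alpha>] .
  have "x \<noteq> n" using n_mem_splits[OF p] x by auto
  then have "x < n" using x by simp
  have "\<not> \<alpha> ` {1..x} \<subseteq> {1..x}" using x by (simp add: splits_def)
  then obtain y where y: "y \<in> {1..x}" "\<alpha> y \<notin> {1..x}" unfolding image_subset_iff by blast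
  then have "x < \<alpha> y" using permutes_gr_0[OF p, of y] by simp
  moreover have "y \<in> {1..n}" using y(1) x by simp
  ultimately have "{y..\<alpha> y} \<subseteq> orbit \<alpha> y" using \<alpha> orbit.base[of \<alpha> y] unfolding IntP_iff by blast
  then have "x \<in> orbit \<alpha> y" "Suc x \<in> orbit \<alpha> y" using y(1) \<open>x < \<alpha> y\<close> by auto
  then have "Suc x \<in> orbit \<alpha> x" using orbit_eq[OF p finite_atLeastAtMost] by simp
  then have "succ_in (orbit \<alpha> x) x = Suc x"
    using succ_in_between[of "Suc x" "orbit \<alpha> x" x] by simp
  then have "\<alpha> x = Suc x" using \<alpha> x(1) by (simp add: IntP_iff increasing_cycles_def)
  then have "inv \<alpha> (Suc x) = x" using permutes_inverses(2)[OF p, of x] by simp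
  then show ?thesis using full_cycle_apply[of x n] x(1) \<open>x < n\<close> by (simp add: kreweras_def)
qed

text \<open>All blocks of the left complement except the one of \<open>n\<close> are singletons, so
  only the blocks of \<open>n\<close> have to be compared, and these are the sets of splitting
  points.\<close>

lemma perm_le_kreweras_iff:
  assumes \<alpha>: "\<alpha> \<in> IntP n" and \<beta>: "\<beta> \<in> NC n" and n: "1 \<le> n"
  shows "perm_le n (kreweras n \<alpha>) (kreweras n \<beta>) \<longleftrightarrow> splits n \<alpha> \<subseteq> splits n \<beta>"
proof -
  let ?a = "kreweras n \<alpha>" and ?b = "kreweras n \<beta>"
  have a: "?a permutes {1..n}" using kreweras_permutes[OF IntP_permutes[OF \<alpha>]] .
  have b: "?b permutes {1..n}" using kreweras_permutes[OF NC_permutes[OF \<beta>]] .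
  have orbit_a: "orbit ?a n = splits n \<alpha>" using orbit_kreweras[OF IntP_NC[OF \<alpha>] n] .
  have orbit_b: "orbit ?b n = splits n \<beta>" using orbit_kreweras[OF \<beta> n] .
  have "perm_le n ?a ?b \<longleftrightarrow> (\<forall>V\<in>cycles_of n ?a. \<exists>W\<in>cycles_of n ?b. V \<subseteq> W)"
    using partition_on_cycles_of[OF a] partition_on_cycles_of[OF b]
    by (simp add: perm_le_def refines_def)
  also have "\<dots> \<longleftrightarrow> splits n \<alpha> \<subseteq> splits n \<beta>"
  proof
    assume *: "\<forall>V\<in>cycles_of n ?a. \<exists>W\<in>cycles_of n ?b. V \<subseteq> W"
    have "orbit ?a n \<in> cycles_of n ?a" using n by (simp add: cycles_of_def)
    then obtain W where W: "W \<in> cycles_of n ?b" "orbit ?a n \<subseteq> W" using * by blast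
    then have "n \<in> W" using self_in_orbit[OF a, of n] by auto
    then have "W = orbit ?b n"
      using W(1) orbit_eq[OF b finite_atLeastAtMost] by (auto simp: cycles_of_def)
    then show "splits n \<alpha> \<subseteq> splits n \<beta>" using W(2) orbit_a orbit_b by simp
  next
    assume sub: "splits n \<alpha> \<subseteq> splits n \<beta>"
    show "\<forall>V\<in>cycles_of n ?a. \<exists>W\<in>cycles_of n ?b. V \<subseteq> W"
    proof
      fix V assume "V \<in> cycles_of n ?a"
      then obtain x where x: "x \<in> {1..n}" "V = orbit ?a x" by (auto simp: cycles_of_def)
      show "\<exists>W\<in>cycles_of n ?b. V \<subseteq> W"
      proof (cases "x \<in> splits n \<alpha>")
        case True
        then have "V = splits n \<alpha>"
          using x(2) orbit_eq[OF a finite_atLeastAtMost, of x n] orbit_a by simp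
        then have "V \<subseteq> orbit ?b n" using sub orbit_b by simp
        then show ?thesis using n by (auto simp: cycles_of_def)
      next
        case False
        then have "V = {x}" using x kreweras_fixes[OF \<alpha>] by (simp add: orbit_eq_singleton_iff)
        then have "V \<subseteq> orbit ?b x" using self_in_orbit[OF b, of x] by simp
        then show ?thesis using x(1) by (auto simp: cycles_of_def)
      qed
    qed
  qed
  finally show ?thesis .
qed

text \<open>The set of splitting points determines the complement: it leads from each of them
  cyclically to the next and fixes all other points. The Kreweras map is injective.\<close>

lemma splits_inject:
  assumes \<alpha>: "\<alpha> \<in> IntP n" and \<beta>: "\<beta> \<in> IntP n" and eq: "splits n \<alpha> = splits n \<beta>"
  shows "\<alpha> = \<beta>"
proof (rule kreweras_inject[OF IntP_permutes[OF \<alpha>] IntP_permutes[OF \<beta>]], rule ext)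
  fix x
  show "kreweras n \<alpha> x = kreweras n \<beta> x"
  proof (cases "x \<in> splits n \<alpha>")
    case True
    then have x: "1 \<le> x" "x \<le> n" using splits_bounds by blast+
    \<comment> \<open>The predecessor convention of \<open>kreweras_step\<close>: \<open>n\<close>
      is represented by 0.\<close>
    define e where "e = (if x = n then 0 else x)"
    have e: "e \<in> insert 0 (splits n \<alpha>)" "e < n" "(if e = 0 then n else e) = x"
      using True x by (auto simp: e_def)
    note 1 = kreweras_step[OF IntP_NC[OF \<alpha>] e(1,2), unfolded e(3)]
    note 2 = kreweras_step[OF IntP_NC[OF \<beta>] e(1,2)[unfolded eq], unfolded e(3), folded eq]
    show ?thesis using 1(3)[OF 2(1,2)] 2(3)[OF 1(1,2)] by simp
  next
    case False
    show ?thesis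
    proof (cases "x \<in> {1..n}")
      case True
      then show ?thesis using False eq kreweras_fixes \<alpha> \<beta> by simp
    next
      case False
      then show ?thesis
        using kreweras_permutes IntP_permutes \<alpha> \<beta> by (metis permutes_not_in)
    qed
  qed
qed

text \<open>The elements of \<open>S\<close> are taken as the right ends of the blocks;
  \<open>n \<in> S\<close> guarantees that every point is covered.\<close>

lemma splits_surj:
  assumes S: "S \<subseteq> {1..n}" "n \<in> S"
  obtains \<alpha> where "\<alpha> \<in> IntP n" "splits n \<alpha> = S"
proof
  \<comment> \<open>\<open>f x\<close> is the right end of the block of \<open>x\<close>. It is
    monotone, so its fibres are intervals.\<close>
  define f where "f x = (LEAST d. d \<in> S \<and> x \<le> d)" for x
  have f: "f x \<in> S" "x \<le> f x" if "x \<le> n" for x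
    using LeastI[of "\<lambda>d. d \<in> S \<and> x \<le> d" n] S(2) that by (auto simp: f_def)
  have f_le: "f x \<le> d" if "d \<in> S" "x \<le> d" for x d
    unfolding f_def by (rule Least_le) (use that in simp)
  have f_self: "f d = d" if "d \<in> S" for d
    using f[of d] f_le[of d d] that S(1) by fastforce
  have f_mono: "f x \<le> f y" if "x \<le> y" "y \<le> n" for x y
    using f_le f that by (meson order_trans)
  define B where "B d = {x \<in> {1..n}. f x = d}" for d
  let ?P = "B ` S"
  have P: "partition_on {1..n} ?P"
    unfolding partition_on_def
  proof (intro conjI disjointI)
    show "\<Union>?P = {1..n}" using f by (auto simp: B_def)
    show "{} \<notin> ?P"
    proof
      assume "{} \<in> ?P"
      then obtain d where "d \<in> S" "B d = {}" by auto
      moreover have "d \<in> B d" using f_self \<open>d \<in> S\<close> S(1) by (auto simp: B_def)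
      ultimately show False by simp
    qed
    show "V \<inter> W = {}" if "V \<in> ?P" "W \<in> ?P" "V \<noteq> W" for V W
      using that by (auto simp: B_def)
  qed
  have "\<exists>i j. V = {i..j}" if V: "V \<in> ?P" for V
  proof -
    obtain d where d: "d \<in> S" "V = B d" using V by auto
    have "d \<in> V" using f_self d S(1) by (auto simp: B_def)
    have fin: "finite V" by (simp add: d B_def)
    then have "Min V \<in> V" using \<open>d \<in> V\<close> by (intro Min_in) auto
    have "V = {Min V..d}"
    proof (intro equalityI subsetI)
      fix x assume x: "x \<in> V"
      then have "x \<le> d" using f[of x] by (auto simp: d B_def)
      then show "x \<in> {Min V..d}" using fin x by simp
    next
      fix x assume x: "x \<in> {Min V..d}"
      have *: "1 \<le> Min V" "f (Min V) = d" "d \<le> n"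
        using \<open>Min V \<in> V\<close> d S(1) by (auto simp: d(2) B_def)
      then have "1 \<le> x" "x \<le> n" using x by auto
      moreover have "f x = d"
        using f_mono[of "Min V" x] f_mono[of x d] f_self[OF d(1)] x * by simp
      ultimately show "x \<in> V" by (simp add: d(2) B_def)
    qed
    then show ?thesis by blast
  qed
  then show "perm_of_partition ?P \<in> IntP n" using P unfolding IntP_def by blast
  have orbit: "orbit (perm_of_partition ?P) x = B (f x)" if "x \<in> {1..n}" for x
    using that f orbit_perm_of_partition[OF P, of "B (f x)" x] by (simp add: B_def)
  show "splits n (perm_of_partition ?P) = S"
  proof (intro equalityI subsetI)
    fix d assume d: "d \<in> splits n (perm_of_partition ?P)"
    then have d_n: "d \<in> {1..n}" using splits_subset by blast
    show "d \<in> S"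
    proof (rule ccontr)
      assume "d \<notin> S"
      then have "d \<noteq> n" using S(2) by auto
      then have "Suc d \<in> {1..n}" using d_n by auto
      \<comment> \<open>As \<open>d\<close> is not in \<open>S\<close>, the points \<open>d\<close>
        and \<open>Suc d\<close> get the same right end. Their common block then leaves
        \<open>{1..d}\<close>, against the assumption that \<open>d\<close> splits.\<close>
      have "e \<in> S \<and> d \<le> e \<longleftrightarrow> e \<in> S \<and> Suc d \<le> e" for e
        using \<open>d \<notin> S\<close> by (auto simp: le_less Suc_le_eq)
      then have "f d = f (Suc d)" by (simp add: f_def)
      then have "Suc d \<in> orbit (perm_of_partition ?P) d"
        using orbit[OF d_n] \<open>Suc d \<in> {1..n}\<close> by (simp add: B_def)
      moreover have "orbit (perm_of_partition ?P) d \<subseteq> {1..d}"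
        using orbit_subset_splits[OF d] d_n by simp
      ultimately show False by auto
    qed
  next
    fix d assume d: "d \<in> S"
    then have d_n: "d \<in> {1..n}" using S(1) by blast
    have "perm_of_partition ?P x \<in> {1..d}" if "x \<in> {1..d}" for x
    proof -
      have "x \<in> {1..n}" using that d_n by simp
      then have "perm_of_partition ?P x \<in> B (f x)"
        using orbit orbit.base[of "perm_of_partition ?P" x] by simp
      moreover have "f x \<le> d" using f_le[OF d] that by simp
      ultimately show ?thesis using f[of "perm_of_partition ?P x"] by (auto simp: B_def)
    qed
    then have "perm_of_partition ?P ` {1..d} \<subseteq> {1..d}" unfolding image_subset_iff by (rule ballI)
    then show "d \<in> splits n (perm_of_partition ?P)" using d_n by (simp add: splits_def)
  qed
qed

lemma kreweras_eq_id_iff: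
  assumes \<alpha>: "\<alpha> \<in> IntP n" and n: "1 \<le> n"
  shows "kreweras n \<alpha> = id \<longleftrightarrow> splits n \<alpha> = {n}"
proof
  assume "kreweras n \<alpha> = id"
  then have "splits n \<alpha> = orbit id n" using orbit_kreweras[OF IntP_NC[OF \<alpha>] n] by simp
  then show "splits n \<alpha> = {n}" using orbit_eq_singleton_iff[of id n] by simp
next
  assume s: "splits n \<alpha> = {n}"
  show "kreweras n \<alpha> = id"
  proof
    fix x
    have "kreweras n \<alpha> n = n"
      using orbit.base[of "kreweras n \<alpha>" n] orbit_kreweras[OF IntP_NC[OF \<alpha>] n] s by simp
    moreover have "kreweras n \<alpha> x = x" if "x \<notin> {1..n}"
      using permutes_not_in[OF kreweras_permutes[OF IntP_permutes[OF \<alpha>]] that] .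
    moreover have "kreweras n \<alpha> x = x" if "x \<in> {1..n}" "x \<noteq> n"
      using kreweras_fixes[OF \<alpha> that(1)] s that(2) by simp
    ultimately show "kreweras n \<alpha> x = id x" by (cases "x = n") auto
  qed
qed

lemma kreweras_eq_id_iff_full_cycle:
  assumes \<alpha>: "\<alpha> permutes {1..n}"
  shows "kreweras n \<alpha> = id \<longleftrightarrow> \<alpha> = full_cycle n"
proof
  have id: "kreweras n (full_cycle n) = id"
    by (simp add: kreweras_def permutes_inv_o[OF full_cycle_permutes])
  show "\<alpha> = full_cycle n" if "kreweras n \<alpha> = id"
    using kreweras_inject[OF \<alpha> full_cycle_permutes] that id by simp
  show "kreweras n \<alpha> = id" if "\<alpha> = full_cycle n" using that id by simp
qed

text \<open>The partition with a single block is the only one that cannot be cut. That the full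
  cycle belongs to \<open>IntP n\<close> follows by realising the set \<open>{n}\<close> as a set of
  splitting points.\<close>

lemma IntP_splits_singleton_iff:
  assumes n: "1 \<le> n"
  shows "\<alpha> \<in> IntP n \<and> splits n \<alpha> = {n} \<longleftrightarrow> \<alpha> = full_cycle n"
proof -
  have *: "\<alpha> = full_cycle n" if "\<alpha> \<in> IntP n" "splits n \<alpha> = {n}" for \<alpha>
    using that kreweras_eq_id_iff[OF that(1) n]
      kreweras_eq_id_iff_full_cycle[OF IntP_permutes[OF that(1)]] by simp
  obtain \<delta> where "\<delta> \<in> IntP n" "splits n \<delta> = {n}" using splits_surj[of "{n}" n] n by auto
  with * show ?thesis by blast
qed

text \<open>Ordered by refinement, \<open>KrInt n\<close> is isomorphic to the subsets of
  \<open>{1..n}\<close> that contain \<open>n\<close>. The meet therefore corresponds to the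
  intersection of the sets of splitting points, even if \<open>\<beta>\<close> is merely
  non-crossing, since all lower bounds are taken in \<open>KrInt n\<close>.\<close>

lemma meet_KrInt_eq_id_iff:
  assumes \<alpha>: "\<alpha> \<in> IntP n" and \<beta>: "\<beta> \<in> NC n" and n: "1 \<le> n"
  shows "meet_KrInt n (kreweras n \<alpha>) (kreweras n \<beta>) = id \<longleftrightarrow> splits n \<alpha> \<inter> splits n \<beta> = {n}"
proof -
  have "splits n \<alpha> \<inter> splits n \<beta> \<subseteq> {1..n}" "n \<in> splits n \<alpha> \<inter> splits n \<beta>"
    using splits_subset n_mem_splits[OF IntP_permutes[OF \<alpha>] n] n_mem_splits[OF NC_permutes[OF \<beta>] n]
    by auto
  then obtain \<delta> where \<delta>: "\<delta> \<in> IntP n" "splits n \<delta> = splits n \<alpha> \<inter> splits n \<beta>"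
    using splits_surj by metis
  have below: "perm_le n (kreweras n \<rho>) (kreweras n \<alpha>) \<and> perm_le n (kreweras n \<rho>) (kreweras n \<beta>) \<longleftrightarrow>
      splits n \<rho> \<subseteq> splits n \<delta>" if "\<rho> \<in> IntP n" for \<rho>
    using that perm_le_kreweras_iff[OF that IntP_NC[OF \<alpha>] n] perm_le_kreweras_iff[OF that \<beta> n]
    by (simp add: \<delta>(2))
  have le: "perm_le n (kreweras n \<rho>) (kreweras n \<sigma>) \<longleftrightarrow> splits n \<rho> \<subseteq> splits n \<sigma>"
    if "\<rho> \<in> IntP n" "\<sigma> \<in> IntP n" for \<rho> \<sigma>
    using perm_le_kreweras_iff[OF that(1) IntP_NC[OF that(2)] n] .
  have "meet_KrInt n (kreweras n \<alpha>) (kreweras n \<beta>) = kreweras n \<delta>"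
    unfolding meet_KrInt_def
  proof (rule the_equality, goal_cases)
    case 1
    then show ?case using \<delta>(1) below le by (auto simp: KrInt_def)
  next
    \<comment> \<open>Uniqueness of the greatest lower bound: antisymmetry of the order comes from
      \<open>splits_inject\<close>.\<close>
    case (2 \<rho>)
    then obtain \<rho>' where \<rho>': "\<rho>' \<in> IntP n" "\<rho> = kreweras n \<rho>'" by (auto simp: KrInt_def)
    have "splits n \<rho>' \<subseteq> splits n \<delta>" using 2 below[OF \<rho>'(1)] \<rho>'(2) by simp
    moreover have "perm_le n (kreweras n \<delta>) \<rho>"
      using 2 below[OF \<delta>(1)] \<delta>(1) by (simp add: KrInt_def)
    then have "splits n \<delta> \<subseteq> splits n \<rho>'" using le[OF \<delta>(1) \<rho>'(1)] \<rho>'(2) by simp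
    ultimately show ?case using splits_inject[OF \<rho>'(1) \<delta>(1)] \<rho>'(2) by simp
  qed
  then show ?thesis using kreweras_eq_id_iff[OF \<delta>(1) n] \<delta>(2) by simp
qed

text \<open>The quotient is \<open>\<alpha> \<circ> inv \<beta>\<close> conjugated by the inverse of
  the full cycle, and \<open>\<alpha> \<circ> inv \<beta>\<close> is in turn the inverse of
  \<open>inv \<alpha> \<circ> \<beta>\<close> conjugated by \<open>\<alpha>\<close>.\<close>

lemma perm_norm_kreweras_quotient:
  assumes \<alpha>: "\<alpha> permutes {1..n}" and \<beta>: "\<beta> permutes {1..n}"
  shows "perm_norm n (inv (kreweras n \<alpha>) \<circ> kreweras n \<beta>) = perm_norm n (inv \<alpha> \<circ> \<beta>)"
proof -
  let ?g = "full_cycle n"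
  note g = full_cycle_permutes[of n]
  note i\<alpha> = permutes_inv[OF \<alpha>] and i\<beta> = permutes_inv[OF \<beta>] and ig = permutes_inv[OF g]
  have inv_comp: "inv (p \<circ> q) = inv q \<circ> inv p" if "p permutes {1..n}" "q permutes {1..n}" for p q
    using permutes_bij[OF that(1)] permutes_bij[OF that(2)] by (rule o_inv_distrib)
  have "inv (kreweras n \<alpha>) \<circ> kreweras n \<beta> = inv ?g \<circ> (\<alpha> \<circ> inv \<beta>) \<circ> inv (inv ?g)"
    by (simp add: kreweras_def inv_comp[OF i\<alpha> g] permutes_inv_inv[OF \<alpha>] permutes_inv_inv[OF g] comp_assoc)
  then have "perm_norm n (inv (kreweras n \<alpha>) \<circ> kreweras n \<beta>) = perm_norm n (\<alpha> \<circ> inv \<beta>)"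
    using perm_norm_conj[OF permutes_compose[OF i\<beta> \<alpha>] ig] by simp
  also have "\<alpha> \<circ> inv \<beta> = \<alpha> \<circ> inv (inv \<alpha> \<circ> \<beta>) \<circ> inv \<alpha>"
  proof -
    have "\<alpha> \<circ> inv (inv \<alpha> \<circ> \<beta>) \<circ> inv \<alpha> = \<alpha> \<circ> inv \<beta> \<circ> (\<alpha> \<circ> inv \<alpha>)"
      by (simp add: inv_comp[OF i\<alpha> \<beta>] permutes_inv_inv[OF \<alpha>] comp_assoc)
    then show ?thesis by (simp add: permutes_inv_o[OF \<alpha>])
  qed
  also have "perm_norm n \<dots> = perm_norm n (inv (inv \<alpha> \<circ> \<beta>))"
    using perm_norm_conj[OF permutes_inv[OF permutes_compose[OF \<beta> i\<alpha>]] \<alpha>] .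
  also have "\<dots> = perm_norm n (inv \<alpha> \<circ> \<beta>)"
    using perm_norm_inv[OF permutes_compose[OF \<beta> i\<alpha>]] .
  finally show ?thesis .
qed

text \<open>The full cycle is the complement of the identity, so this is a case of the formula for
  quotients.\<close>

lemma perm_norm_inv_kreweras_full_cycle:
  assumes \<alpha>: "\<alpha> permutes {1..n}"
  shows "perm_norm n (inv (kreweras n \<alpha>) \<circ> full_cycle n) = perm_norm n \<alpha>"
proof -
  have "kreweras n id = full_cycle n" by (simp add: kreweras_def)
  then have "perm_norm n (inv (kreweras n \<alpha>) \<circ> full_cycle n) = perm_norm n (inv \<alpha> \<circ> id)"
    using perm_norm_kreweras_quotient[OF \<alpha> permutes_id] by simp
  then show ?thesis using perm_norm_inv[OF \<alpha>] by simp
qed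

subsection \<open>Decomposition at the first common splitting point\<close>

text \<open>The pairs that cannot be cut. The family \<open>T\<close> is kept general so that pairs
  from \<open>IntP\<close> and \<open>L\<close> and diagonal pairs share one decomposition.\<close>

definition irreducibles ::
  "(nat \<Rightarrow> ((nat \<Rightarrow> nat) \<times> (nat \<Rightarrow> nat)) set) \<Rightarrow> nat \<Rightarrow> ((nat \<Rightarrow> nat) \<times> (nat \<Rightarrow> nat)) set" where
  "irreducibles T k = {p \<in> T k. splits k (fst p) \<inter> splits k (snd p) = {k}}"

text \<open>Pairs are grouped by their least common splitting point \<open>k\<close>. Concatenation
  is a bijection from irreducible pairs of size \<open>k\<close> and arbitrary pairs of size
  \<open>n - k\<close> onto the group of \<open>k\<close>, and the weight is multiplicative.\<close>

lemma sum_first_common_split: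
  fixes w :: "nat \<Rightarrow> (nat \<Rightarrow> nat) \<times> (nat \<Rightarrow> nat) \<Rightarrow> 'a :: comm_semiring_1"
  assumes permutes: "\<And>n \<alpha> \<beta>. (\<alpha>, \<beta>) \<in> T n \<Longrightarrow> \<alpha> permutes {1..n} \<and> \<beta> permutes {1..n}"
    and T_cat: "\<And>k m \<alpha> \<beta> \<alpha>' \<beta>'. \<alpha> permutes {1..k} \<Longrightarrow> \<beta> permutes {1..k} \<Longrightarrow>
      \<alpha>' permutes {1..m} \<Longrightarrow> \<beta>' permutes {1..m} \<Longrightarrow>
      (cat k \<alpha> \<alpha>', cat k \<beta> \<beta>') \<in> T (k + m) \<longleftrightarrow> (\<alpha>, \<beta>) \<in> T k \<and> (\<alpha>', \<beta>') \<in> T m"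
    and w_cat: "\<And>k m \<alpha> \<beta> \<alpha>' \<beta>'. \<alpha> permutes {1..k} \<Longrightarrow> \<beta> permutes {1..k} \<Longrightarrow>
      \<alpha>' permutes {1..m} \<Longrightarrow> \<beta>' permutes {1..m} \<Longrightarrow>
      w (k + m) (cat k \<alpha> \<alpha>', cat k \<beta> \<beta>') = w k (\<alpha>, \<beta>) * w m (\<alpha>', \<beta>')"
    and n: "1 \<le> n"
  shows "sum (w n) (T n) = (\<Sum>k=1..n. sum (w k) (irreducibles T k) * sum (w (n - k)) (T (n - k)))"
proof -
  define C where "C p = splits n (fst p) \<inter> splits n (snd p)" for p
  have fin_C: "finite (C p)" for p
    using finite_subset[OF splits_subset finite_atLeastAtMost] by (simp add: C_def)
  have C_mem: "Min (C p) \<in> C p" if "p \<in> T n" for p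
  proof (rule Min_in[OF fin_C])
    have "fst p permutes {1..n}" "snd p permutes {1..n}"
      using permutes[of "fst p" "snd p" n] that by simp_all
    then have "n \<in> C p" using n_mem_splits n by (simp add: C_def)
    then show "C p \<noteq> {}" by blast
  qed
  have C_bounds: "d \<in> {1..n}" if "d \<in> C p" for d p
    using that splits_bounds[of d n "fst p"] by (simp add: C_def)
  have "T n \<subseteq> {\<pi>. \<pi> permutes {1..n}} \<times> {\<pi>. \<pi> permutes {1..n}}"
    using permutes by auto
  then have fin_T: "finite (T n)"
    using finite_subset finite_permutations[of "{1..n}"] by (metis finite_SigmaI finite_atLeastAtMost)
  have "sum (w n) (T n) = (\<Sum>k=1..n. \<Sum>p\<in>{p \<in> T n. Min (C p) = k}. w n p)"
    by (rule sum.group[symmetric, OF fin_T finite_atLeastAtMost])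
      (rule image_subsetI, erule C_bounds[OF C_mem])
  also have "\<dots> = (\<Sum>k=1..n. sum (w k) (irreducibles T k) * sum (w (n - k)) (T (n - k)))"
  proof (rule sum.cong[OF refl])
    fix k assume k: "k \<in> {1..n}"
    define m where "m = n - k"
    have n_eq: "n = k + m" using k by (simp add: m_def)
    define h where "h = (\<lambda>(p, q). (cat k (fst p) (fst q), cat k (snd p) (snd q)) ::
      (nat \<Rightarrow> nat) \<times> (nat \<Rightarrow> nat))"
    have perms: "fst p permutes {1..k}" "snd p permutes {1..k}" "fst q permutes {1..m}" "snd q permutes {1..m}"
      if "p \<in> irreducibles T k" "q \<in> T m" for p q
      using that permutes[of "fst p" "snd p" k] permutes[of "fst q" "snd q" m]
      by (simp_all add: irreducibles_def)
    have inj: "inj_on h (irreducibles T k \<times> T m)"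
    proof (rule inj_onI)
      fix x y assume "x \<in> irreducibles T k \<times> T m" "y \<in> irreducibles T k \<times> T m" and eq: "h x = h y"
      then have x: "fst x \<in> irreducibles T k" "snd x \<in> T m"
        and y: "fst y \<in> irreducibles T k" "snd y \<in> T m" by (simp_all add: mem_Times_iff)
      note p = perms[OF x] perms[OF y]
      show "x = y"
        using eq cat_inject[OF p(3,7,1,5)] cat_inject[OF p(4,8,2,6)]
        by (simp add: h_def split_def prod_eq_iff)
    qed
    have image: "h ` (irreducibles T k \<times> T m) = {p \<in> T n. Min (C p) = k}"
    proof (intro equalityI subsetI)
      fix x assume "x \<in> h ` (irreducibles T k \<times> T m)"
      then obtain p q where x: "p \<in> irreducibles T k" "q \<in> T m"
        "x = (cat k (fst p) (fst q), cat k (snd p) (snd q))"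
        by (auto simp: h_def)
      note P = perms[OF x(1,2)]
      have "x \<in> T n" using T_cat[OF P] x by (simp add: n_eq irreducibles_def)
      \<comment> \<open>Up to \<open>k\<close> the common splitting points come from the irreducible
        left pair, so the minimum is \<open>k\<close> for every right pair.\<close>
      moreover have C_iff: "d \<in> C x \<longleftrightarrow> d = k" if "d \<le> k" for d
        using that mem_splits_cat[OF P(1,3) that] mem_splits_cat[OF P(2,4) that] x
        by (auto simp: C_def n_eq irreducibles_def)
      then have "Min (C x) = k"
        by (intro Min_eqI fin_C) (auto intro: leI)
      ultimately show "x \<in> {p \<in> T n. Min (C p) = k}" by simp
    next
      fix x assume "x \<in> {p \<in> T n. Min (C p) = k}"
      then have x: "x \<in> T n" "Min (C x) = k" by simp_all
      \<comment> \<open>Both components preserve \<open>{1..k}\<close>, so they can be cut at the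
        same place.\<close>
      have "k \<in> C x" using C_mem[OF x(1)] x(2) by simp
      then have "fst x ` {1..k} \<subseteq> {1..k}" "snd x ` {1..k} \<subseteq> {1..k}"
        by (simp_all add: C_def splits_def)
      moreover have "fst x permutes {1..k + m}" "snd x permutes {1..k + m}"
        using permutes[of "fst x" "snd x" n] x(1) by (simp_all add: n_eq)
      ultimately obtain \<alpha> \<alpha>' \<beta> \<beta>'
        where P: "\<alpha> permutes {1..k}" "\<beta> permutes {1..k}" "\<alpha>' permutes {1..m}" "\<beta>' permutes {1..m}"
          and eq: "fst x = cat k \<alpha> \<alpha>'" "snd x = cat k \<beta> \<beta>'"
        using cat_exists by metis
      have x_eq: "x = (cat k \<alpha> \<alpha>', cat k \<beta> \<beta>')" using eq by (simp add: prod_eq_iff)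
      then have T: "(\<alpha>, \<beta>) \<in> T k" "(\<alpha>', \<beta>') \<in> T m"
        using T_cat[OF P] x(1) by (simp_all add: n_eq)
      have C_iff: "d \<in> C x \<longleftrightarrow> d \<in> splits k \<alpha> \<inter> splits k \<beta>" if "d \<le> k" for d
        using mem_splits_cat[OF P(1,3) that] mem_splits_cat[OF P(2,4) that]
        by (simp add: C_def eq n_eq)
      have "splits k \<alpha> \<inter> splits k \<beta> = {k}"
      proof (intro equalityI subsetI)
        fix d assume d: "d \<in> splits k \<alpha> \<inter> splits k \<beta>"
        then have "d \<le> k" using splits_bounds(2)[of d k \<alpha>] by simp
        then have "d \<in> C x" using d C_iff by simp
        then have "k \<le> d" using x(2) fin_C Min_le by metis
        then show "d \<in> {k}" using \<open>d \<le> k\<close> by simp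
      next
        fix d assume "d \<in> {k}"
        then show "d \<in> splits k \<alpha> \<inter> splits k \<beta>" using \<open>k \<in> C x\<close> C_iff[of k] by simp
      qed
      then have "(\<alpha>, \<beta>) \<in> irreducibles T k" using T(1) by (simp add: irreducibles_def)
      then have "((\<alpha>, \<beta>), (\<alpha>', \<beta>')) \<in> irreducibles T k \<times> T m" using T(2) by simp
      moreover have "x = h ((\<alpha>, \<beta>), (\<alpha>', \<beta>'))" by (simp add: h_def x_eq)
      ultimately show "x \<in> h ` (irreducibles T k \<times> T m)" by (rule rev_image_eqI)
    qed
    have "(\<Sum>p\<in>{p \<in> T n. Min (C p) = k}. w n p) = (\<Sum>x\<in>irreducibles T k \<times> T m. w n (h x))"
      unfolding image[symmetric] by (simp add: sum.reindex[OF inj])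
    also have "\<dots> = (\<Sum>(p, q)\<in>irreducibles T k \<times> T m. w k p * w m q)"
    proof (rule sum.cong[OF refl], clarify)
      fix \<alpha> \<beta> \<alpha>' \<beta>'
      assume *: "(\<alpha>, \<beta>) \<in> irreducibles T k" "(\<alpha>', \<beta>') \<in> T m"
      show "w n (h ((\<alpha>, \<beta>), (\<alpha>', \<beta>'))) = w k (\<alpha>, \<beta>) * w m (\<alpha>', \<beta>')"
        using w_cat[OF perms[OF *]] by (simp add: h_def n_eq)
    qed
    also have "\<dots> = sum (w k) (irreducibles T k) * sum (w m) (T m)"
      by (simp add: sum_product sum.cartesian_product)
    finally show "(\<Sum>p\<in>{p \<in> T n. Min (C p) = k}. w n p) =
        sum (w k) (irreducibles T k) * sum (w (n - k)) (T (n - k))"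
      by (simp add: m_def)
  qed
  finally show ?thesis .
qed

text \<open>The summand of \<open>m_poly\<close>; after transport along the Kreweras map it is also
  the summand of \<open>kappa_poly\<close>.\<close>

definition pair_weight :: "nat \<Rightarrow> (nat \<Rightarrow> nat) \<times> (nat \<Rightarrow> nat) \<Rightarrow> poly3" where
  "pair_weight n = (\<lambda>(\<alpha>, \<beta>).
     var_Y ^ perm_norm n (inv \<alpha> \<circ> \<beta>) * var_A ^ perm_norm n \<alpha> * var_B ^ perm_norm n \<beta>)"

lemma pair_weight_cat:
  assumes "\<alpha> permutes {1..k}" "\<beta> permutes {1..k}" "\<alpha>' permutes {1..m}" "\<beta>' permutes {1..m}"
  shows "pair_weight (k + m) (cat k \<alpha> \<alpha>', cat k \<beta> \<beta>') =
    pair_weight k (\<alpha>, \<beta>) * pair_weight m (\<alpha>', \<beta>')"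
proof -
  have "inv (cat k \<alpha> \<alpha>') \<circ> cat k \<beta> \<beta>' = cat k (inv \<alpha> \<circ> \<beta>) (inv \<alpha>' \<circ> \<beta>')"
    by (simp add: inv_cat[OF assms(1,3)] cat_comp[OF assms(2,4)])
  then have "perm_norm (k + m) (inv (cat k \<alpha> \<alpha>') \<circ> cat k \<beta> \<beta>') =
      perm_norm k (inv \<alpha> \<circ> \<beta>) + perm_norm m (inv \<alpha>' \<circ> \<beta>')"
    using perm_norm_cat[OF permutes_compose[OF assms(2) permutes_inv[OF assms(1)]]
        permutes_compose[OF assms(4) permutes_inv[OF assms(3)]]] by simp
  then show ?thesis
    using perm_norm_cat[OF assms(1,3)] perm_norm_cat[OF assms(2,4)]
    by (simp add: pair_weight_def power_add mult_ac)
qed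

section \<open>Size zero and the sum over interval partitions\<close>

lemma increasing_cycles_0: "increasing_cycles 0 \<alpha> \<longleftrightarrow> \<alpha> = id"
  by (auto simp: increasing_cycles_def permutes_empty)

lemma IntP_0: "IntP 0 = {id}"
  by (auto simp: IntP_iff increasing_cycles_0)

lemma NC_0: "NC 0 = {id}"
  by (auto simp: NC_iff increasing_cycles_0)

lemma cycles_of_full_cycle:
  assumes "1 \<le> n"
  shows "cycles_of n (full_cycle n) = {{1..n}}"
proof -
  have "orbit (full_cycle n) x = {1..n}" if "x \<in> {1..n}" for x
    using cycle_of_sorted_list(2)[OF finite_atLeastAtMost that] by (simp only: full_cycle_eq)
  then have "orbit (full_cycle n) ` {1..n} = (\<lambda>_. {1..n}) ` {1..n}"
    by (rule image_cong[OF refl])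
  then show ?thesis unfolding cycles_of_def using assms by auto
qed

text \<open>The diagonal pairs \<open>(\<sigma>, \<sigma>)\<close> reduce this to the decomposition of pairs.\<close>

lemma IntP_sum_rec:
  fixes f :: "nat \<Rightarrow> 'a :: comm_semiring_1"
  assumes n: "1 \<le> n"
  shows "(\<Sum>\<sigma>\<in>IntP n. \<Prod>c\<in>cycles_of n \<sigma>. f (card c)) =
    (\<Sum>k=1..n. f k * (\<Sum>\<sigma>\<in>IntP (n - k). \<Prod>c\<in>cycles_of (n - k) \<sigma>. f (card c)))"
proof -
  define T :: "nat \<Rightarrow> ((nat \<Rightarrow> nat) \<times> (nat \<Rightarrow> nat)) set" where "T m = (\<lambda>\<sigma>. (\<sigma>, \<sigma>)) ` IntP m" for m
  define w where "w m = (\<lambda>(\<alpha>, \<beta> :: nat \<Rightarrow> nat). \<Prod>c\<in>cycles_of m \<alpha>. f (card c))" for m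
  have T_iff: "(\<alpha>, \<beta>) \<in> T m \<longleftrightarrow> \<alpha> = \<beta> \<and> \<alpha> \<in> IntP m" for \<alpha> \<beta> m
    by (auto simp: T_def)
  have sum_T: "sum (w m) (T m) = (\<Sum>\<sigma>\<in>IntP m. \<Prod>c\<in>cycles_of m \<sigma>. f (card c))" for m
    by (simp add: T_def w_def sum.reindex inj_on_def)
  have sum_irreducibles: "sum (w k) (irreducibles T k) = f k" if "1 \<le> k" for k
  proof -
    \<comment> \<open>A diagonal pair is irreducible only if its partition has one block, so the
      left factor contributes just \<open>f k\<close>.\<close>
    have "(\<alpha>, \<beta>) \<in> irreducibles T k \<longleftrightarrow> \<alpha> = full_cycle k \<and> \<beta> = full_cycle k" for \<alpha> \<beta>
      using IntP_splits_singleton_iff[OF that, of \<alpha>] by (auto simp: irreducibles_def T_iff)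
    then have "irreducibles T k = {(full_cycle k, full_cycle k)}" by auto
    then show ?thesis by (simp add: w_def cycles_of_full_cycle[OF that])
  qed
  have "sum (w n) (T n) =
      (\<Sum>k=1..n. sum (w k) (irreducibles T k) * sum (w (n - k)) (T (n - k)))"
  proof (rule sum_first_common_split[OF _ _ _ n], goal_cases)
    case (1 m \<alpha> \<beta>)
    then have "\<alpha> = \<beta>" "\<alpha> \<in> IntP m" by (auto simp: T_iff)
    then show ?case using IntP_permutes[of \<alpha> m] by simp
  next
    case (2 k m \<alpha> \<beta> \<alpha>' \<beta>')
    then show ?case
      using IntP_cat_iff[OF 2(1,3)] cat_inject[OF 2(3,4,1,2)] by (auto simp: T_iff)
  next
    case (3 k m \<alpha> \<beta> \<alpha>' \<beta>')
    have "card ((\<lambda>y. y + k) ` c) = card c" for c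
      by (intro card_image) (simp add: inj_on_def)
    then show ?case using prod_cycles_of_cat[OF 3(1,3), of "\<lambda>c. f (card c)"] by (simp add: w_def)
  qed
  then show ?thesis using sum_irreducibles by (simp add: sum_T)
qed

section \<open>The polynomials for a fixed family \<open>L\<close>\<close>

context
  fixes L :: "nat \<Rightarrow> (nat \<Rightarrow> nat) set"
  assumes L: "L = NC \<or> L = IntP"
begin

lemma L_NC: "\<alpha> \<in> L n \<Longrightarrow> \<alpha> \<in> NC n"
  using L IntP_NC by blast

lemma L_cat_iff:
  assumes "\<alpha> permutes {1..k}" "\<beta> permutes {1..m}"
  shows "cat k \<alpha> \<beta> \<in> L (k + m) \<longleftrightarrow> \<alpha> \<in> L k \<and> \<beta> \<in> L m"
  using L NC_cat_iff[OF assms] IntP_cat_iff[OF assms] by auto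

text \<open>The sum is reindexed by taking complements of both components: a trivial meet becomes
  irreducibility, and the three exponents become those of \<open>pair_weight\<close>.\<close>

lemma kappa_poly_eq:
  assumes n: "1 \<le> n"
  shows "kappa_poly L n = sum (pair_weight n) (irreducibles (\<lambda>n. IntP n \<times> L n) n)"
proof -
  let ?T = "irreducibles (\<lambda>n. IntP n \<times> L n) n"
  let ?K = "\<lambda>p. (kreweras n (fst p), kreweras n (snd p))"
  have perm: "fst p permutes {1..n}" "snd p permutes {1..n}" if "p \<in> ?T" for p
    using that IntP_permutes NC_permutes[OF L_NC] by (auto simp: irreducibles_def)
  have meet: "meet_KrInt n (kreweras n \<alpha>) (kreweras n \<beta>) = id \<longleftrightarrow> (\<alpha>, \<beta>) \<in> ?T"
    if "\<alpha> \<in> IntP n" "\<beta> \<in> L n" for \<alpha> \<beta>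
    using meet_KrInt_eq_id_iff[OF that(1) L_NC[OF that(2)] n] that by (simp add: irreducibles_def)
  have "{(\<alpha>, \<beta>). \<alpha> \<in> KrInt n \<and> \<beta> \<in> kreweras n ` L n \<and> meet_KrInt n \<alpha> \<beta> = id} = ?K ` ?T"
  proof (intro equalityI subsetI)
    fix x assume "x \<in> {(\<alpha>, \<beta>). \<alpha> \<in> KrInt n \<and> \<beta> \<in> kreweras n ` L n \<and> meet_KrInt n \<alpha> \<beta> = id}"
    then obtain \<alpha> \<beta> where *: "\<alpha> \<in> IntP n" "\<beta> \<in> L n" "x = (kreweras n \<alpha>, kreweras n \<beta>)"
      "meet_KrInt n (kreweras n \<alpha>) (kreweras n \<beta>) = id"
      unfolding KrInt_def by blast
    then have "(\<alpha>, \<beta>) \<in> ?T" using meet by simp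
    then show "x \<in> ?K ` ?T" by (rule rev_image_eqI) (simp add: *)
  next
    fix x assume "x \<in> ?K ` ?T"
    then obtain \<alpha> \<beta> where *: "(\<alpha>, \<beta>) \<in> ?T" "x = (kreweras n \<alpha>, kreweras n \<beta>)" by auto
    then have "\<alpha> \<in> IntP n" "\<beta> \<in> L n" by (auto simp: irreducibles_def)
    then show "x \<in> {(\<alpha>, \<beta>). \<alpha> \<in> KrInt n \<and> \<beta> \<in> kreweras n ` L n \<and> meet_KrInt n \<alpha> \<beta> = id}"
      using * meet by (simp add: KrInt_def)
  qed
  moreover have "inj_on ?K ?T"
  proof (rule inj_onI)
    fix p q assume *: "p \<in> ?T" "q \<in> ?T" "?K p = ?K q"
    then show "p = q"
      using kreweras_inject[OF perm(1)[OF *(1)] perm(1)[OF *(2)]]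
        kreweras_inject[OF perm(2)[OF *(1)] perm(2)[OF *(2)]]
      by (simp add: prod_eq_iff)
  qed
  ultimately have "kappa_poly L n = (\<Sum>p\<in>?T. (\<lambda>(\<alpha>, \<beta>). var_Y ^ perm_norm n (inv \<alpha> \<circ> \<beta>) *
       var_A ^ perm_norm n (inv \<alpha> \<circ> full_cycle n) *
       var_B ^ perm_norm n (inv \<beta> \<circ> full_cycle n)) (?K p))"
    unfolding kappa_poly_def by (simp add: sum.reindex)
  also have "\<dots> = sum (pair_weight n) ?T"
  proof (rule sum.cong[OF refl])
    fix p assume "p \<in> ?T"
    note p = perm[OF this]
    show "(\<lambda>(\<alpha>, \<beta>). var_Y ^ perm_norm n (inv \<alpha> \<circ> \<beta>) *
       var_A ^ perm_norm n (inv \<alpha> \<circ> full_cycle n) *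
       var_B ^ perm_norm n (inv \<beta> \<circ> full_cycle n)) (?K p) = pair_weight n p"
      by (simp add: pair_weight_def split_def perm_norm_kreweras_quotient[OF p]
          perm_norm_inv_kreweras_full_cycle[OF p(1)] perm_norm_inv_kreweras_full_cycle[OF p(2)])
  qed
  finally show ?thesis .
qed

lemma m_poly_0: "m_poly L 0 = 1"
proof -
  have "L 0 = {id}" using L IntP_0 NC_0 by auto
  then show ?thesis by (simp add: m_poly_def IntP_0 perm_norm_def)
qed

lemma m_poly_rec:
  assumes n: "1 \<le> n"
  shows "m_poly L n = (\<Sum>k=1..n. kappa_poly L k * m_poly L (n - k))"
proof -
  let ?T = "\<lambda>n. IntP n \<times> L n"
  have m: "m_poly L i = sum (pair_weight i) (?T i)" for i
    by (simp add: m_poly_def pair_weight_def)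
  have "sum (pair_weight n) (?T n) = (\<Sum>k=1..n. sum (pair_weight k) (irreducibles ?T k) *
      sum (pair_weight (n - k)) (?T (n - k)))"
  proof (rule sum_first_common_split[OF _ _ pair_weight_cat n], goal_cases)
    case (1 i \<alpha> \<beta>)
    then have "\<alpha> \<in> IntP i" "\<beta> \<in> L i" by simp_all
    then show ?case using IntP_permutes NC_permutes[OF L_NC] by blast
  next
    case (2 k i \<alpha> \<beta> \<alpha>' \<beta>')
    then show ?case using IntP_cat_iff[OF 2(1,3)] L_cat_iff[OF 2(2,4)] by auto
  qed
  also have "\<dots> = (\<Sum>k=1..n. kappa_poly L k * m_poly L (n - k))"
    by (rule sum.cong[OF refl]) (simp add: kappa_poly_eq m)
  finally show ?thesis by (simp only: m)
qed

text \<open>Strong induction: both sides obey the same recursion and equal 1 at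
  \<open>n = 0\<close>, where the product is empty.\<close>

lemma m_poly_eq_sum_IntP:
  "m_poly L n = (\<Sum>\<sigma>\<in>IntP n. \<Prod>c\<in>cycles_of n \<sigma>. kappa_poly L (card c))"
proof (induct n rule: less_induct)
  case (less n)
  show ?case
  proof (cases "n = 0")
    case True
    then show ?thesis by (simp add: m_poly_0 IntP_0 cycles_of_def)
  next
    case False
    then have n: "1 \<le> n" by simp
    have "m_poly L n = (\<Sum>k=1..n. kappa_poly L k * m_poly L (n - k))"
      using m_poly_rec[OF n] .
    also have "\<dots> = (\<Sum>k=1..n. kappa_poly L k *
        (\<Sum>\<sigma>\<in>IntP (n - k). \<Prod>c\<in>cycles_of (n - k) \<sigma>. kappa_poly L (card c)))"
      by (rule sum.cong[OF refl]) (use less n in simp)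
    also have "\<dots> = (\<Sum>\<sigma>\<in>IntP n. \<Prod>c\<in>cycles_of n \<sigma>. kappa_poly L (card c))"
      using IntP_sum_rec[OF n, of "kappa_poly L"] by simp
    finally show ?thesis .
  qed
qed

text \<open>Since \<open>m_poly L 0 = 1\<close>, the series \<open>?M\<close> has the coefficients
  \<open>m_poly L n\<close> for all \<open>n\<close>, and the recursion reads
  \<open>?M = 1 + ?K * ?M\<close>.\<close>

lemma one_plus_gen_series_m_poly:
  "(1 + gen_series (m_poly L)) * (1 - gen_series (kappa_poly L)) = 1"
proof -
  let ?M = "1 + gen_series (m_poly L)" and ?K = "gen_series (kappa_poly L)"
  have M_nth: "fps_nth ?M n = m_poly L n" for n
    by (simp add: gen_series_def m_poly_0)
  have "?M = 1 + ?K * ?M"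
  proof (rule fps_ext)
    fix n
    show "fps_nth ?M n = fps_nth (1 + ?K * ?M) n"
    proof (cases "n = 0")
      case True
      then show ?thesis by (simp add: gen_series_def)
    next
      case False
      have "fps_nth (?K * ?M) n = (\<Sum>k=0..n. fps_nth ?K k * m_poly L (n - k))"
        by (simp only: fps_mult_nth M_nth)
      \<comment> \<open>The term for \<open>k = 0\<close> vanishes because \<open>?K\<close> has no
        constant term.\<close>
      also have "\<dots> = (\<Sum>k=1..n. fps_nth ?K k * m_poly L (n - k))"
        by (rule sum.mono_neutral_right) (auto simp: gen_series_def)
      also have "\<dots> = (\<Sum>k=1..n. kappa_poly L k * m_poly L (n - k))"
        by (rule sum.cong[OF refl]) (simp add: gen_series_def)
      also have "\<dots> = m_poly L n" using m_poly_rec[of n] False by simp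
      finally show ?thesis using False by (simp add: gen_series_def)
    qed
  qed
  then show ?thesis by (simp add: algebra_simps)
qed

end

text \<open>The quotient M = K/(1 - K) is expressed without division: 1 - K is a unit, and M times 1
  - K is K. Both follow from (1 + M)(1 - K) = 1.\<close>

theorem theorem3p8:
  fixes L :: "nat \<Rightarrow> (nat \<Rightarrow> nat) set"
  assumes "L = NC \<or> L = IntP"
  shows "(\<forall>n\<ge>1. m_poly L n = (\<Sum>\<sigma>\<in>IntP n. \<Prod>c\<in>cycles_of n \<sigma>. kappa_poly L (card c)))
    \<and> (1 - gen_series (kappa_poly L)) dvd 1
    \<and> gen_series (m_poly L) * (1 - gen_series (kappa_poly L)) = gen_series (kappa_poly L)"
proof (intro conjI allI impI)
  let ?M = "gen_series (m_poly L)" and ?K = "gen_series (kappa_poly L)"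
  have inverse: "(1 + ?M) * (1 - ?K) = 1" using one_plus_gen_series_m_poly[OF assms] .
  show "m_poly L n = (\<Sum>\<sigma>\<in>IntP n. \<Prod>c\<in>cycles_of n \<sigma>. kappa_poly L (card c))" for n
    using m_poly_eq_sum_IntP[OF assms] .
  show "(1 - ?K) dvd 1" using inverse by (metis dvd_triv_right)
  show "?M * (1 - ?K) = ?K" using inverse by (simp add: algebra_simps)
qed

end
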